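(* Let $n\geq 1$ and $1\leq k\leq n$. Then $$\tau_k(Q_n)=\prod_{j=k+1}^n(2j)^{\binom{n}{j}\binom{j-2}{k-1}}.$$
   Context: $Q_n$ is the $n$-dimensional unit cube regarded as a cell complex, whose cells are its nonempty faces. A cellular spanning $k$-tree of $Q_n$ is a $k$-dimensional subcomplex $Y\subseteq Q_n$ containing all faces of $Q_n$ of dimension $\le k-1$ (i.e. with the same $(k-1)$-skeleton as $Q_n$) such that $\tilde H_k(Y;\mathbb{Z})=0$, $|\tilde H_{k-1}(Y;\mathbb{Z})|<\infty$, and the number of $k$-cells satisfies $|Y_k|=|Z_k|-\tilde\beta_k(Z)+\tilde\beta_{k-1}(Z)$, where $Z$ is the $k$-skeleton of $Q_n$ and $Z_k$ its set of $k$-cells. Here $\tilde H$ and $\tilde\beta$ denote reduced homology and reduced Betti numbers. $\mathcal{T}_k(Q_n)$ is the set of all such $Y$, and $$\tau_k(Q_n)=\sum_{Y\in\mathcal{T}_k(Q_n)}|\tilde H_{k-1}(Y;\mathbb{Z})|^2.$$ An empty product is $1$. *)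

theory Defs
  imports "HOL-Algebra.Free_Abelian_Groups" Complex_Main
begin

section \<open>The unit cube as a cell complex\<close>

text \<open>
  The nonempty faces of the unit cube in \<open>n\<close>-space are the products of \<open>n\<close> factors, each of which
  is \<open>{0}\<close>, \<open>{1}\<close> or \<open>[0,1]\<close>. A face is stored as the list of its factors; \<open>realization\<close> gives the
  actual point set, with points of \<open>n\<close>-space as real lists of length \<open>n\<close>.
\<close>

datatype side = Zero | One | Star

type_synonym face = "side list"

fun side_set :: "side \<Rightarrow> real set" where
  "side_set Zero = {0}"
| "side_set One = {1}"
| "side_set Star = {0..1}"

definition realization :: "face \<Rightarrow> real list set" where
  "realization F = {x. length x = length F \<and> (\<forall>i<length F. x ! i \<in> side_set (F ! i))}"

definition face_dim :: "face \<Rightarrow> nat" where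
  "face_dim F = card {i. i < length F \<and> F ! i = Star}"

definition cube :: "nat \<Rightarrow> face set" where
  "cube n = {F. length F = n}"

definition subcomplex :: "face set \<Rightarrow> face set \<Rightarrow> bool" where
  "subcomplex Y X \<longleftrightarrow> Y \<subseteq> X \<and> (\<forall>G\<in>Y. \<forall>F\<in>X. realization F \<subseteq> realization G \<longrightarrow> F \<in> Y)"

definition cells :: "face set \<Rightarrow> nat \<Rightarrow> face set" where
  "cells Y p = {F \<in> Y. face_dim F = p}"

definition skeleton :: "face set \<Rightarrow> nat \<Rightarrow> face set" where
  "skeleton Y p = {F \<in> Y. face_dim F \<le> p}"

definition has_dim :: "face set \<Rightarrow> nat \<Rightarrow> bool" where
  "has_dim Y p \<longleftrightarrow> (\<forall>F\<in>Y. face_dim F \<le> p) \<and> (\<exists>F\<in>Y. face_dim F = p)"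


section \<open>Reduced cellular homology\<close>

text \<open>
  Cells carry the product orientation. For the \<open>r\<close>-th (counting from \<open>0\<close>) free direction \<open>i\<close> of \<open>F\<close>,
  the facets \<open>x\<^sub>i = 1\<close> and \<open>x\<^sub>i = 0\<close> have incidence numbers \<open>(-1)\<^sup>r\<close> and \<open>-(-1)\<^sup>r\<close>.
\<close>

definition cell_boundary :: "face \<Rightarrow> face \<Rightarrow>\<^sub>0 int" where
  "cell_boundary F =
    (\<Sum>i | i < length F \<and> F ! i = Star.
      frag_cmul ((-1) ^ card {j. j < i \<and> F ! j = Star})
        (frag_of (F[i := One]) - frag_of (F[i := Zero])))"

definition bd :: "(face \<Rightarrow>\<^sub>0 int) \<Rightarrow> (face \<Rightarrow>\<^sub>0 int)" where
  "bd = frag_extend cell_boundary"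

definition augmentation :: "(face \<Rightarrow>\<^sub>0 int) \<Rightarrow> int" where
  "augmentation c = (\<Sum>F\<in>Poly_Mapping.keys c. Poly_Mapping.lookup c F)"

definition chain_group :: "face set \<Rightarrow> nat \<Rightarrow> (face \<Rightarrow>\<^sub>0 int) monoid" where
  "chain_group Y p = free_Abelian_group (cells Y p)"

definition reduced_cycles :: "face set \<Rightarrow> nat \<Rightarrow> (face \<Rightarrow>\<^sub>0 int) set" where
  "reduced_cycles Y p =
    {c \<in> carrier (chain_group Y p). if p = 0 then augmentation c = 0 else bd c = 0}"

definition boundaries :: "face set \<Rightarrow> nat \<Rightarrow> (face \<Rightarrow>\<^sub>0 int) set" where
  "boundaries Y p = bd ` carrier (chain_group Y (Suc p))"

definition reduced_homology :: "face set \<Rightarrow> nat \<Rightarrow> (face \<Rightarrow>\<^sub>0 int) set monoid" where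
  "reduced_homology Y p =
    subgroup_generated (chain_group Y p) (reduced_cycles Y p) Mod boundaries Y p"

text \<open>The (torsion-free) rank of an abelian group, meaningful when it is finite.\<close>

definition int_independent :: "('a, 'b) monoid_scheme \<Rightarrow> 'a set \<Rightarrow> bool" where
  "int_independent G S \<longleftrightarrow> finite S \<and> S \<subseteq> carrier G \<and>
    (\<forall>c :: 'a \<Rightarrow> int. finprod G (\<lambda>x. x [^]\<^bsub>G\<^esub> c x) S = \<one>\<^bsub>G\<^esub> \<longrightarrow> (\<forall>x\<in>S. c x = 0))"

definition abelian_rank :: "('a, 'b) monoid_scheme \<Rightarrow> nat" where
  "abelian_rank G = Sup {card S |S. int_independent G S}"

definition reduced_betti :: "face set \<Rightarrow> nat \<Rightarrow> nat" where
  "reduced_betti Y p = abelian_rank (reduced_homology Y p)"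


section \<open>Cellular spanning trees\<close>

definition spanning_trees :: "nat \<Rightarrow> nat \<Rightarrow> face set set" where
  "spanning_trees n k = {Y.
     subcomplex Y (cube n) \<and> has_dim Y k \<and> skeleton (cube n) (k - 1) \<subseteq> Y \<and>
     trivial_group (reduced_homology Y k) \<and>
     finite (carrier (reduced_homology Y (k - 1))) \<and>
     (let Z = skeleton (cube n) k in
       int (card (cells Y k)) =
         int (card (cells Z k)) - int (reduced_betti Z k) + int (reduced_betti Z (k - 1)))}"

definition tree_number :: "nat \<Rightarrow> nat \<Rightarrow> nat" where
  "tree_number n k = (\<Sum>Y\<in>spanning_trees n k. (order (reduced_homology Y (k - 1)))\<^sup>2)"


section \<open>Well-definedness\<close>

lemma finite_spanning_trees: "finite (spanning_trees n k)"
proof -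
  have "finite (UNIV :: side set)"
  proof (rule finite_subset)
    show "(UNIV :: side set) \<subseteq> {Zero, One, Star}" using side.exhaust by blast
  qed simp
  then have "finite (cube n)"
    using finite_lists_length_eq[of "UNIV :: side set" n] by (simp add: cube_def)
  then show ?thesis
    by (rule finite_subset[rotated, OF finite_Pow_iff[THEN iffD2]])
      (auto simp: spanning_trees_def subcomplex_def)
qed

lemma side_set_subset: "side_set a \<subseteq> side_set b \<longleftrightarrow> b = Star \<or> a = b"
proof -
  have "(1/2 :: real) \<in> {0..1}" "(1/2 :: real) \<noteq> 0" "(1/2 :: real) \<noteq> 1" by auto
  then show ?thesis
    by (cases a; cases b) (auto dest: subsetD[where c = "1/2"])
qed

lemma realization_subset:
  assumes "length F = length G"
  shows "realization F \<subseteq> realization G \<longleftrightarrow> (\<forall>i<length G. G ! i = Star \<or> F ! i = G ! i)"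
proof
  assume sub: "realization F \<subseteq> realization G"
  show "\<forall>i<length G. G ! i = Star \<or> F ! i = G ! i"
  proof (intro allI impI)
    fix i assume i: "i < length G"
    have "side_set (F ! i) \<subseteq> side_set (G ! i)"
    proof
      fix t assume t: "t \<in> side_set (F ! i)"
      define x where "x = (map (\<lambda>a. if a = One then 1 else 0 :: real) F)[i := t]"
      have "side_set a \<noteq> {} \<and> (if a = One then 1 else 0) \<in> side_set a" for a
        by (cases a) auto
      then have "x \<in> realization F"
        using t i assms by (auto simp: x_def realization_def nth_list_update)
      then have "x ! i \<in> side_set (G ! i)" using sub i by (auto simp: realization_def)
      then show "t \<in> side_set (G ! i)" using i assms by (simp add: x_def)
    qed
    then show "G ! i = Star \<or> F ! i = G ! i" by (simp add: side_set_subset)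
  qed
next
  assume "\<forall>i<length G. G ! i = Star \<or> F ! i = G ! i"
  then have "\<forall>i<length G. side_set (F ! i) \<subseteq> side_set (G ! i)" by (simp add: side_set_subset)
  then show "realization F \<subseteq> realization G" using assms by (auto simp: realization_def)
qed

lemma bd_add: "bd (a + b) = bd a + bd b" and bd_minus: "bd (- a) = - bd a"
  and bd_0 [simp]: "bd 0 = 0" and bd_of [simp]: "bd (frag_of F) = cell_boundary F"
  by (simp_all add: bd_def frag_extend_add frag_extend_minus)

lemma bd_diff: "bd (a - b) = bd a - bd b"
  by (simp add: bd_def frag_extend_diff)

abbreviation prefix_chain :: "side \<Rightarrow> (face \<Rightarrow>\<^sub>0 int) \<Rightarrow> (face \<Rightarrow>\<^sub>0 int)" where
  "prefix_chain a \<equiv> frag_extend (\<lambda>F. frag_of (a # F))"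

lemma cell_boundary_Nil: "cell_boundary [] = 0"
  by (simp add: cell_boundary_def)

lemma cell_boundary_Cons:
  "cell_boundary (a # F) =
     (if a = Star then frag_of (One # F) - frag_of (Zero # F) - prefix_chain Star (cell_boundary F)
      else prefix_chain a (cell_boundary F))"
proof -
  let ?I = "{i. i < length F \<and> F ! i = Star}"
  let ?t = "\<lambda>G i. frag_cmul ((-1) ^ card {j. j < i \<and> G ! j = Star})
        (frag_of (G[i := One]) - frag_of (G[i := Zero]))"
  have I: "{i. i < length (a # F) \<and> (a # F) ! i = Star}
      = (if a = Star then {0} else {}) \<union> Suc ` ?I" (is "?J = _")
  proof (rule Set.set_eqI)
    fix i show "i \<in> ?J \<longleftrightarrow> i \<in> (if a = Star then {0} else {}) \<union> Suc ` ?I"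
      by (cases i) auto
  qed
  have c: "{j. j < Suc i \<and> (a # F) ! j = Star}
      = (if a = Star then {0} else {}) \<union> Suc ` {j. j < i \<and> F ! j = Star}" (is "?L = ?R") for i
  proof (rule Set.set_eqI)
    fix j show "j \<in> ?L \<longleftrightarrow> j \<in> ?R"
      by (cases j) auto
  qed
  have t: "?t (a # F) (Suc i) = (if a = Star then - prefix_chain a (?t F i) else prefix_chain a (?t F i))" for i
    by (simp add: c card_image card_insert_if frag_extend_cmul frag_extend_diff image_iff)
  have s: "(\<Sum>i\<in>Suc ` ?I. ?t (a # F) i)
      = (if a = Star then - prefix_chain a (cell_boundary F) else prefix_chain a (cell_boundary F))"
    unfolding cell_boundary_def
    by (simp only: sum.reindex inj_Suc comp_def t) (simp add: frag_extend_sum sum_negf comp_def)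
  show ?thesis
  proof (cases "a = Star")
    case True
    then have "cell_boundary (a # F) = ?t (a # F) 0 + (\<Sum>i\<in>Suc ` ?I. ?t (a # F) i)"
      unfolding cell_boundary_def[of "a # F"] I by (simp add: sum.insert)
    then show ?thesis using True s by simp
  next
    case False
    then show ?thesis unfolding cell_boundary_def[of "a # F"] I using s by simp
  qed
qed

lemma bd_prefix:
  "bd (prefix_chain a c) =
     (if a = Star then prefix_chain One c - prefix_chain Zero c - prefix_chain Star (bd c)
      else prefix_chain a (bd c))"
proof (induction c rule: frag_induction[OF subset_UNIV, case_names zero one diff])
  case (diff a b)
  then show ?case by (simp add: frag_extend_diff bd_diff split: if_splits)
qed (auto simp: cell_boundary_Cons)

lemma bd_cell_boundary: "bd (cell_boundary F) = 0"
proof (induction F)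
  case Nil
  then show ?case by (simp add: cell_boundary_Nil)
next
  case (Cons a F)
  then show ?case by (simp add: cell_boundary_Cons bd_diff bd_prefix)
qed

lemma bd_bd: "bd (bd c) = 0"
  by (induction c rule: frag_induction[OF subset_UNIV, case_names zero one diff]) (simp_all add: bd_cell_boundary bd_diff)

lemma augmentation_eq:
  "augmentation c = Poly_Mapping.lookup (frag_extend (\<lambda>_. frag_of ()) c) ()"
  by (simp add: augmentation_def frag_extend_def lookup_sum)

lemma augmentation_bd: "augmentation (bd c) = 0"
proof (induction c rule: frag_induction[OF subset_UNIV, case_names zero one diff])
  case (one F)
  show ?case
    by (simp add: augmentation_eq cell_boundary_def frag_extend_sum frag_extend_cmul frag_extend_diff
        comp_def lookup_sum)
qed (simp_all add: augmentation_eq bd_diff frag_extend_diff lookup_minus)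

lemma face_dim_update:
  assumes "i < length F" "F ! i = Star" "a \<noteq> Star"
  shows "face_dim F = Suc (face_dim (F[i := a]))"
proof -
  have "{j. j < length F \<and> F ! j = Star}
      = insert i {j. j < length (F[i := a]) \<and> F[i := a] ! j = Star}"
    using assms by (auto simp: nth_list_update)
  then show ?thesis
    using assms by (simp add: face_dim_def)
qed

lemma keys_cell_boundary:
  assumes Y: "subcomplex Y (cube n)" and F: "F \<in> cells Y (Suc p)"
  shows "Poly_Mapping.keys (cell_boundary F) \<subseteq> cells Y p"
proof -
  have upd: "F[i := a] \<in> cells Y p" if i: "i < length F" "F ! i = Star" "a \<noteq> Star" for i a
  proof -
    have "realization (F[i := a]) \<subseteq> realization F"
      using i by (subst realization_subset) (auto simp: nth_list_update)
    then have "F[i := a] \<in> Y"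
      using Y F by (auto simp: subcomplex_def cells_def cube_def)
    then show ?thesis
      using F face_dim_update[OF i] by (simp add: cells_def)
  qed
  have "cell_boundary F \<in> carrier (free_Abelian_group (cells Y p))"
    unfolding cell_boundary_def
  proof (rule sum_closed_free_Abelian_group)
    fix i assume "i \<in> {i. i < length F \<and> F ! i = Star}"
    then have "F[i := One] \<in> cells Y p" "F[i := Zero] \<in> cells Y p" by (auto intro: upd)
    then have "Poly_Mapping.keys (frag_of (F[i := One]) - frag_of (F[i := Zero])) \<subseteq> cells Y p"
      using keys_diff[of "frag_of (F[i := One])" "frag_of (F[i := Zero])"] by auto
    then show "frag_cmul ((-1) ^ card {j. j < i \<and> F ! j = Star})
        (frag_of (F[i := One]) - frag_of (F[i := Zero])) \<in> carrier (free_Abelian_group (cells Y p))"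
      by auto
  qed
  then show ?thesis by simp
qed

lemma boundaries_subset_reduced_cycles:
  assumes "subcomplex Y (cube n)"
  shows "boundaries Y p \<subseteq> reduced_cycles Y p"
proof
  fix b assume "b \<in> boundaries Y p"
  then obtain c where c: "Poly_Mapping.keys c \<subseteq> cells Y (Suc p)" "b = bd c"
    by (auto simp: boundaries_def chain_group_def)
  have "Poly_Mapping.keys b \<subseteq> cells Y p"
    using keys_frag_extend[of cell_boundary c] c keys_cell_boundary[OF assms]
    unfolding bd_def by blast
  then show "b \<in> reduced_cycles Y p"
    using c by (simp add: reduced_cycles_def chain_group_def bd_bd augmentation_bd)
qed

lemma subgroup_reduced_cycles: "subgroup (reduced_cycles Y p) (chain_group Y p)"
proof (rule group.subgroupI)
  show "group (chain_group Y p)" by (simp add: chain_group_def)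
  show "reduced_cycles Y p \<subseteq> carrier (chain_group Y p)" by (auto simp: reduced_cycles_def)
  show "reduced_cycles Y p \<noteq> {}"
    by (rule ex_in_conv[THEN iffD1], rule exI[of _ 0])
      (simp add: reduced_cycles_def chain_group_def augmentation_def)
next
  fix a assume "a \<in> reduced_cycles Y p"
  then show "inv\<^bsub>chain_group Y p\<^esub> a \<in> reduced_cycles Y p"
    by (auto simp: reduced_cycles_def chain_group_def bd_minus augmentation_eq frag_extend_minus
        split: if_splits)
next
  fix a b assume "a \<in> reduced_cycles Y p" "b \<in> reduced_cycles Y p"
  then show "a \<otimes>\<^bsub>chain_group Y p\<^esub> b \<in> reduced_cycles Y p"
    using keys_add[of a b]
    by (auto simp: reduced_cycles_def chain_group_def bd_add augmentation_eq frag_extend_add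
        lookup_add split: if_splits)
qed

lemma carrier_reduced_cycles:
  "carrier (subgroup_generated (chain_group Y p) (reduced_cycles Y p)) = reduced_cycles Y p"
  by (metis chain_group_def subgroup.carrier_subgroup_generated_subgroup group_free_Abelian_group
      subgroup_reduced_cycles)

end

theory Submission
  imports Defs "Jordan_Normal_Form.Determinant"
begin

text \<open>
  Write \<open>\<partial>\<close> for the boundary map from \<open>k\<close>-cells to \<open>(k - 1)\<close>-cells. The cube is acyclic, so the reduced
  cycles in dimension \<open>k - 1\<close> are exactly the boundaries, and they form a free group \<open>B\<close>. In a basis of \<open>B\<close> the map
  \<open>\<partial>\<close> is an integer matrix \<open>D\<close>. A set \<open>S\<close> of \<open>k\<close>-cells, added to the \<open>(k - 1)\<close>-skeleton, gives a spanning
  tree iff the columns \<open>D\<^sub>S\<close> form a nonsingular square matrix, and then the homology group in dimension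
  \<open>k - 1\<close> is the quotient of \<open>B\<close> by the lattice of these columns, of order \<open>\<bar>det D\<^sub>S\<bar>\<close>
  (\<open>order_reduced_homology\<close>, \<open>spanning_trees_iff\<close>). By the Cauchy--Binet formula the weighted number of
  trees is therefore \<open>t k = det (D D\<^sup>T)\<close> (\<open>tree_number_eq_tree_det\<close>).

  The numbers \<open>t k\<close> are computed without reference to trees. The rows of \<open>D\<close> span a primitive lattice
  whose orthogonal complement is the lattice of \<open>k\<close>-cycles, so \<open>t k\<close> is also the Gram determinant of a
  basis of the \<open>k\<close>-cycles (\<open>cycle_gram_eq_tree_det\<close>). The Laplacian \<open>\<partial>\<partial>\<^sup>T + \<partial>\<^sup>T\<partial>\<close> on \<open>k\<close>-cells preserves the
  cycles and their complement, and in bases adapted to the two its determinant becomes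
  \<open>t (k + 1) (t k)\<^sup>2 t (k - 1)\<close> for \<open>k \<ge> 2\<close> (\<open>det_laplacian_tree_det\<close>). On the other hand, the Laplacian of a product is
  a sum over the factors, so on \<open>k\<close>-cells of the cube it has the eigenvalue \<open>2j\<close> with multiplicity
  \<open>binom(n, j) binom(j, k)\<close> (\<open>det_laplacian\<close>). Comparing the two yields the formula by descending
  induction on \<open>k\<close> (\<open>tree_det_formula\<close>).

  The basis of \<open>B\<close> comes from a matching: each cell whose first factor different from \<open>Zero\<close> is \<open>One\<close> is
  paired with the cell that has \<open>Star\<close> in its place. The boundary map is unitriangular between the two
  classes of cells (\<open>det_incidence_one_star\<close>). Hence the coefficients on the first class are integral
  coordinates on \<open>B\<close>, the boundaries of the second class are a basis of \<open>B\<close>, and acyclicity follows too.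
  In the lemmas \<open>tree_det n p\<close> stands for \<open>t (p + 1)\<close>, so that \<open>p\<close> is the dimension of the homology group
  that is counted.
\<close>

section \<open>Matrices indexed by lists\<close>

definition list_mat :: "'a list \<Rightarrow> 'b list \<Rightarrow> ('a \<Rightarrow> 'b \<Rightarrow> 'c) \<Rightarrow> 'c mat" where
  "list_mat xs ys f = mat (length xs) (length ys) (\<lambda>(i, j). f (xs ! i) (ys ! j))"

lemma list_mat_carrier [simp]: "list_mat xs ys f \<in> carrier_mat (length xs) (length ys)"
  by (simp add: list_mat_def)

lemma dim_list_mat [simp]:
  "dim_row (list_mat xs ys f) = length xs" "dim_col (list_mat xs ys f) = length ys"
  by (simp_all add: list_mat_def)

lemma index_list_mat [simp]:
  "i < length xs \<Longrightarrow> j < length ys \<Longrightarrow> list_mat xs ys f $$ (i, j) = f (xs ! i) (ys ! j)"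
  by (simp add: list_mat_def)

lemma transpose_list_mat [simp]:
  "transpose_mat (list_mat xs ys f) = list_mat ys xs (\<lambda>y x. f x y)"
  by (rule eq_matI) auto

lemma list_mat_cong:
  assumes "\<And>x y. x \<in> set xs \<Longrightarrow> y \<in> set ys \<Longrightarrow> f x y = g x y"
  shows "list_mat xs ys f = list_mat xs ys g"
  by (rule eq_matI) (auto simp: assms)

lemma list_mat_map:
  "list_mat (map h xs) (map k ys) f = list_mat xs ys (\<lambda>x y. f (h x) (k y))"
  by (rule eq_matI) auto

lemma sum_nth_distinct:
  assumes "distinct ys"
  shows "(\<Sum>i<length ys. f (ys ! i)) = (\<Sum>y\<in>set ys. f y)"
  using sum.reindex_bij_betw[OF bij_betw_nth[OF assms refl refl]] by (simp add: atLeast0LessThan)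

lemma list_mat_mult:
  assumes "distinct ys"
  shows "list_mat xs ys f * list_mat ys zs g = list_mat xs zs (\<lambda>x z. \<Sum>y\<in>set ys. f x y * g y z)"
  by (rule eq_matI)
    (auto simp: scalar_prod_def sum_nth_distinct[OF assms, symmetric] atLeast0LessThan)

lemma list_mat_one:
  assumes "distinct xs"
  shows "list_mat xs xs (\<lambda>x y. if x = y then 1 else 0) = 1\<^sub>m (length xs)"
  by (rule eq_matI) (auto simp: nth_eq_iff_index_eq[OF assms])

lemma list_mat_append:
  "list_mat (xs @ xs') (ys @ ys') f =
    four_block_mat (list_mat xs ys f) (list_mat xs ys' f) (list_mat xs' ys f) (list_mat xs' ys' f)"
  by (rule eq_matI) (auto simp: nth_append)

lemma list_mat_zero:
  assumes "\<And>x y. x \<in> set xs \<Longrightarrow> y \<in> set ys \<Longrightarrow> f x y = 0"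
  shows "list_mat xs ys f = 0\<^sub>m (length xs) (length ys)"
  by (rule eq_matI) (auto simp: assms)

lemma det_list_mat_block_lower:
  fixes f :: "'a \<Rightarrow> 'b \<Rightarrow> 'c :: idom"
  assumes "length xs = length ys" "length xs' = length ys'"
    and "\<And>x y. x \<in> set xs \<Longrightarrow> y \<in> set ys' \<Longrightarrow> f x y = 0"
  shows "det (list_mat (xs @ xs') (ys @ ys') f) = det (list_mat xs ys f) * det (list_mat xs' ys' f)"
  unfolding list_mat_append
  using assms(1,2)
  by (intro det_four_block_mat_upper_right_zero[of _ "length ys" _ "length ys'"])
    (auto simp: list_mat_zero[OF assms(3)] carrier_matI)

lemma det_list_mat_block_upper:
  fixes f :: "'a \<Rightarrow> 'b \<Rightarrow> 'c :: idom"
  assumes "length xs = length ys" "length xs' = length ys'"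
    and "\<And>x y. x \<in> set xs' \<Longrightarrow> y \<in> set ys \<Longrightarrow> f x y = 0"
  shows "det (list_mat (xs @ xs') (ys @ ys') f) = det (list_mat xs ys f) * det (list_mat xs' ys' f)"
  unfolding list_mat_append
  using assms(1,2)
  by (intro det_four_block_mat_lower_left_zero[of _ "length ys" _ "length ys'"])
    (auto simp: list_mat_zero[OF assms(3)] carrier_matI)

text \<open>
  Both matrices are conjugate under the permutation matrix that compares the two enumerations, so the
  determinant of a square matrix with equal row and column index sets depends on the set only.
\<close>

lemma det_list_mat_reorder:
  fixes f :: "'a \<Rightarrow> 'a \<Rightarrow> 'c :: comm_ring_1"
  assumes xs: "distinct xs" and ys: "distinct ys" and eq: "set xs = set ys"
  shows "det (list_mat xs xs f) = det (list_mat ys ys f)"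
proof -
  have len: "length xs = length ys"
    using xs ys eq by (metis distinct_card)
  let ?\<delta> = "\<lambda>x y. if x = y then 1 else 0 :: 'c"
  let ?P = "list_mat xs ys ?\<delta>" and ?Q = "list_mat ys xs ?\<delta>"
  have QP: "?Q * ?P = 1\<^sub>m (length ys)"
    using eq by (simp add: list_mat_mult[OF xs] if_distrib[where f="\<lambda>c. c * _"] sum.delta'
        flip: list_mat_one[OF ys] cong: if_cong) (rule list_mat_cong, simp add: sum.delta')
  have "list_mat xs xs f = ?P * list_mat ys ys f * ?Q"
    using eq by (auto simp: list_mat_mult[OF ys] if_distrib[where f="\<lambda>c. c * _"] 
        if_distrib[where f="\<lambda>c. _ * c"] sum.delta sum.delta'  cong: if_cong intro!: list_mat_cong)
  then have "det (list_mat xs xs f) = det ?P * det (list_mat ys ys f) * det ?Q"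
    using len by (simp add: det_mult[of _ "length ys"] carrier_matI)
  also have "\<dots> = det (list_mat ys ys f) * det (?Q * ?P)"
    using len by (subst det_mult[of _ "length ys"]) (auto simp: carrier_matI mult_ac)
  finally show ?thesis by (simp add: QP)
qed

lemma list_mat_add: "list_mat xs ys f + list_mat xs ys g = list_mat xs ys (\<lambda>x y. f x y + g x y)"
  by (rule eq_matI) auto

lemma list_mat_diff: "list_mat xs ys f - list_mat xs ys g = list_mat xs ys (\<lambda>x y. f x y - g x y)"
  by (rule eq_matI) auto

lemma det_list_mat_Nil [simp]: "det (list_mat [] [] f) = 1"
  using list_mat_carrier[of "[]" "[]" f] by simp

lemma det_list_mat_singleton [simp]: "det (list_mat [x] [y] f) = f x y"
  using list_mat_carrier[of "[x]" "[y]" f] by (simp add: det_single)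

section \<open>The Cauchy--Binet formula\<close>

definition enum_set :: "'a set \<Rightarrow> 'a list" where
  "enum_set S = (SOME xs. distinct xs \<and> set xs = S)"

lemma enum_set:
  assumes "finite S"
  shows "distinct (enum_set S)" "set (enum_set S) = S" "length (enum_set S) = card S"
proof -
  have "distinct (enum_set S) \<and> set (enum_set S) = S"
    unfolding enum_set_def by (rule someI_ex) (use finite_distinct_list[OF assms] in blast)
  then show "distinct (enum_set S)" "set (enum_set S) = S" by auto
  then show "length (enum_set S) = card S" using distinct_card[of "enum_set S"] by simp
qed

text \<open>
  The maps with image \<open>set xs\<close> are the bijections \<open>i \<mapsto> xs ! p i\<close> for permutations \<open>p\<close>. Reordering
  the rows of the second factor by \<open>p\<close> costs the sign of \<open>p\<close>, and with this sign the products of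
  entries of the first factor add up to its determinant.
\<close>

lemma cauchy_binet_injections:
  fixes f :: "'e \<Rightarrow> 'a \<Rightarrow> 'c :: comm_ring_1"
  assumes xs: "distinct xs" and len: "length xs = length es"
  shows "(\<Sum>\<phi> | \<phi> \<in> {..<length es} \<rightarrow>\<^sub>E set xs \<and> \<phi> ` {..<length es} = set xs.
            (\<Prod>i<length es. f (es ! i) (\<phi> i)) * det (list_mat (map \<phi> [0..<length es]) es g))
       = det (list_mat es xs f) * det (list_mat xs es g)" (is "(\<Sum>\<phi>\<in>?\<Phi>. ?h \<phi>) = _")
proof -
  define r where "r = length es"
  let ?P = "{p. p permutes {0..<r}}"
  have nth: "bij_betw ((!) xs) {0..<r} (set xs)"
    using bij_betw_nth[OF xs refl refl] by (simp add: r_def len atLeast0LessThan)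
  let ?to = "\<lambda>p. restrict (\<lambda>i. xs ! p i) {..<r}"
  have bij: "bij_betw ?to ?P ?\<Phi>"
    unfolding bij_betw_def
  proof
    show "inj_on ?to ?P"
    proof
      fix p q assume p: "p \<in> ?P" and q: "q \<in> ?P" and pq: "?to p = ?to q"
      show "p = q"
      proof
        fix i show "p i = q i"
        proof (cases "i < r")
          case True
          then have "xs ! p i = xs ! q i" using fun_cong[OF pq, of i] by simp
          moreover have "p i < r" "q i < r"
            using True permutes_in_image[of p "{0..<r}" i] permutes_in_image[of q "{0..<r}" i] p q
            by auto
          ultimately show ?thesis using xs by (simp add: nth_eq_iff_index_eq len r_def)
        qed (use p q in \<open>auto simp: permutes_def\<close>)
      qed
    qed
    show "?to ` ?P = ?\<Phi>"
    proof (intro equalityI subsetI)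
      fix \<phi> assume "\<phi> \<in> ?to ` ?P"
      then obtain p where p: "p permutes {0..<r}" "\<phi> = ?to p" by auto
      have "\<phi> ` {0..<r} = ((!) xs) ` (p ` {0..<r})"
        using p(2) by (auto simp: image_image)
      also have "\<dots> = set xs"
        using nth p(1) by (simp add: permutes_image bij_betw_def)
      finally show "\<phi> \<in> ?\<Phi>"
        using p by (auto simp: PiE_def r_def atLeast0LessThan)
    next
      fix \<phi> assume \<phi>: "\<phi> \<in> ?\<Phi>"
      define p where "p i = (if i < r then the_inv_into {0..<r} ((!) xs) (\<phi> i) else i)" for i
      have im: "\<phi> ` {0..<r} = set xs" using \<phi> by (auto simp: r_def atLeast0LessThan)
      then have "inj_on \<phi> {0..<r}"
        by (intro eq_card_imp_inj_on) (simp_all add: distinct_card[OF xs] len r_def)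
      then have "bij_betw \<phi> {0..<r} (set xs)"
        using im by (simp add: bij_betw_def)
      from bij_betw_trans[OF this bij_betw_the_inv_into[OF nth]]
      have "bij_betw p {0..<r} {0..<r}"
        by (rule bij_betw_cong[THEN iffD1, rotated]) (simp add: p_def)
      then have "p permutes {0..<r}"
        by (rule bij_imp_permutes) (simp add: p_def)
      moreover have "\<phi> = ?to p"
      proof
        fix i show "\<phi> i = ?to p i"
        proof (cases "i < r")
          case True
          then have "\<phi> i \<in> set xs" using im by auto
          then show ?thesis using True f_the_inv_into_f_bij_betw[OF nth] by (simp add: p_def)
        qed (use \<phi> in \<open>auto simp: r_def PiE_def extensional_def\<close>)
      qed
      ultimately show "\<phi> \<in> ?to ` ?P" by blast
    qed
  qed
  have "(\<Sum>\<phi>\<in>?\<Phi>. ?h \<phi>) = (\<Sum>p\<in>?P. ?h (?to p))"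
    by (rule sum.reindex_bij_betw[OF bij, symmetric])
  also have "\<dots> = (\<Sum>p\<in>?P. signof p * (\<Prod>i = 0..<r. list_mat es xs f $$ (i, p i))
                    * det (list_mat xs es g))"
  proof (rule sum.cong[OF refl])
    fix p assume "p \<in> ?P"
    then have p: "p permutes {0..<r}" by simp
    then have pr: "p i < r" if "i < r" for i
      using permutes_in_image[OF p, of i] that by simp
    have "list_mat (map (?to p) [0..<r]) es g = mat r r (\<lambda>(i, j). list_mat xs es g $$ (p i, j))"
      by (rule eq_matI) (use pr in \<open>auto simp: len r_def\<close>)
    then have "det (list_mat (map (?to p) [0..<r]) es g) = signof p * det (list_mat xs es g)"
      using det_permute_rows[OF _ p, of "list_mat xs es g"] by (simp add: len r_def carrier_matI)
    moreover have "(\<Prod>i<r. f (es ! i) (?to p i)) = (\<Prod>i = 0..<r. list_mat es xs f $$ (i, p i))"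
      using pr by (auto simp: atLeast0LessThan len r_def intro!: prod.cong)
    ultimately show "?h (?to p)
        = signof p * (\<Prod>i = 0..<r. list_mat es xs f $$ (i, p i)) * det (list_mat xs es g)"
      by (simp add: mult_ac flip: r_def)
  qed
  also have "\<dots> = det (list_mat es xs f) * det (list_mat xs es g)"
    by (subst det_def'[of "list_mat es xs f" r])
      (auto simp: r_def len sum_distrib_right carrier_matI)
  finally show ?thesis .
qed

text \<open>
  Multilinearity in the rows expands the determinant over all maps \<open>\<phi>\<close> from row positions to \<open>C\<close>. A map
  that is not injective repeats a row and contributes nothing; the injective ones are grouped by
  their image.
\<close>

theorem cauchy_binet:
  fixes f :: "'e \<Rightarrow> 'a \<Rightarrow> 'c :: comm_ring_1"
  assumes C: "finite C"
  shows "det (list_mat es es (\<lambda>e e'. \<Sum>c\<in>C. f e c * g c e')) =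
    (\<Sum>S | S \<subseteq> C \<and> card S = length es.
       det (list_mat es (enum_set S) f) * det (list_mat (enum_set S) es g))"
proof -
  define r where "r = length es"
  let ?F = "{..<r} \<rightarrow>\<^sub>E C"
  let ?h = "\<lambda>\<phi>. (\<Prod>i<r. f (es ! i) (\<phi> i)) * det (list_mat (map \<phi> [0..<r]) es g)"
  have permutes_less: "p i < length es" if "p permutes {0..<length es}" "i < length es" for p i
    using permutes_in_image[OF that(1), of i] that(2) by simp
  have finF: "finite ?F" using C by (simp add: finite_PiE)
  have "det (list_mat es es (\<lambda>e e'. \<Sum>c\<in>C. f e c * g c e')) =
    (\<Sum>p | p permutes {0..<r}. signof p * (\<Prod>i = 0..<r. \<Sum>c\<in>C. f (es ! i) c * g c (es ! p i)))"
    by (subst det_def'[of _ r]) (auto simp: r_def permutes_less carrier_matI intro!: sum.cong prod.cong)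
  also have "\<dots> = (\<Sum>p | p permutes {0..<r}. \<Sum>\<phi>\<in>?F.
      signof p * (\<Prod>i<r. f (es ! i) (\<phi> i) * g (\<phi> i) (es ! p i)))"
    by (simp add: prod_sum_PiE C sum_distrib_left atLeast0LessThan)
  also have "\<dots> = (\<Sum>\<phi>\<in>?F. \<Sum>p | p permutes {0..<r}.
      signof p * (\<Prod>i<r. f (es ! i) (\<phi> i) * g (\<phi> i) (es ! p i)))"
    by (rule sum.swap)
  also have "\<dots> = (\<Sum>\<phi>\<in>?F. ?h \<phi>)"
  proof (rule sum.cong[OF refl])
    fix \<phi>
    have "det (list_mat (map \<phi> [0..<r]) es g)
        = (\<Sum>p | p permutes {0..<r}. signof p * (\<Prod>i<r. g (\<phi> i) (es ! p i)))"
      by (subst det_def'[of _ r])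
        (auto simp: r_def atLeast0LessThan permutes_less carrier_matI intro!: sum.cong prod.cong)
    then show "(\<Sum>p | p permutes {0..<r}.
        signof p * (\<Prod>i<r. f (es ! i) (\<phi> i) * g (\<phi> i) (es ! p i))) = ?h \<phi>"
      by (simp add: prod.distrib sum_distrib_left mult_ac)
  qed
  also have "\<dots> = (\<Sum>\<phi> | \<phi> \<in> ?F \<and> inj_on \<phi> {..<r}. ?h \<phi>)"
  proof (rule sum.mono_neutral_right[OF finF])
    show "\<forall>\<phi>\<in>?F - {\<phi> \<in> ?F. inj_on \<phi> {..<r}}. ?h \<phi> = 0"
    proof
      fix \<phi> assume "\<phi> \<in> ?F - {\<phi> \<in> ?F. inj_on \<phi> {..<r}}"
      then obtain i j where ij: "i < r" "j < r" "\<phi> i = \<phi> j" "i \<noteq> j"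
        by (auto simp: inj_on_def)
      have "det (list_mat (map \<phi> [0..<r]) es g) = 0"
      proof (rule det_identical_rows[OF _ ij(4,1,2)])
        show "list_mat (map \<phi> [0..<r]) es g \<in> carrier_mat r r"
          by (simp add: carrier_matI r_def)
        show "row (list_mat (map \<phi> [0..<r]) es g) i = row (list_mat (map \<phi> [0..<r]) es g) j"
          using ij by (intro eq_vecI) auto
      qed
      then show "?h \<phi> = 0" by simp
    qed
  qed auto
  also have "\<dots> = (\<Sum>S | S \<subseteq> C \<and> card S = r.
      \<Sum>\<phi> | \<phi> \<in> {\<phi> \<in> ?F. inj_on \<phi> {..<r}} \<and> \<phi> ` {..<r} = S. ?h \<phi>)"
  proof (rule sum.group[symmetric])
    show "finite {\<phi> \<in> ?F. inj_on \<phi> {..<r}}" "finite {S. S \<subseteq> C \<and> card S = r}"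
      using finF C by simp_all
    show "(\<lambda>\<phi>. \<phi> ` {..<r}) ` {\<phi> \<in> ?F. inj_on \<phi> {..<r}} \<subseteq> {S. S \<subseteq> C \<and> card S = r}"
      by (auto simp: card_image PiE_iff)
  qed
  also have "\<dots> = (\<Sum>S | S \<subseteq> C \<and> card S = r.
       det (list_mat es (enum_set S) f) * det (list_mat (enum_set S) es g))"
  proof (rule sum.cong[OF refl])
    fix S assume S: "S \<in> {S. S \<subseteq> C \<and> card S = r}"
    then have fin: "finite S" using C finite_subset by auto
    have "{\<phi> \<in> {\<phi> \<in> ?F. inj_on \<phi> {..<r}}. \<phi> ` {..<r} = S}
        = {\<phi>. \<phi> \<in> {..<r} \<rightarrow>\<^sub>E S \<and> \<phi> ` {..<r} = S}"
      using S by (auto simp: PiE_iff eq_card_imp_inj_on)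
    then show "(\<Sum>\<phi> | \<phi> \<in> {\<phi> \<in> ?F. inj_on \<phi> {..<r}} \<and> \<phi> ` {..<r} = S. ?h \<phi>)
        = det (list_mat es (enum_set S) f) * det (list_mat (enum_set S) es g)"
      using cauchy_binet_injections[of "enum_set S" es f g] enum_set[OF fin] S
      by (simp add: r_def)
  qed
  finally show ?thesis by (simp add: r_def)
qed

section \<open>The index of a lattice spanned by the columns of an integer matrix\<close>

definition in_col_lattice :: "int mat \<Rightarrow> (nat \<Rightarrow> int) \<Rightarrow> bool" where
  "in_col_lattice A v \<longleftrightarrow> (\<exists>w. \<forall>i<dim_row A. v i = (\<Sum>j<dim_col A. A $$ (i, j) * w j))"

lemma in_col_lattice_addcol_imp:
  assumes kl: "k \<noteq> l" "k < dim_col A" "l < dim_col A" and v: "in_col_lattice (addcol a k l A) v"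
  shows "in_col_lattice A v"
proof -
  obtain w where w: "\<And>i. i < dim_row A \<Longrightarrow> v i = (\<Sum>j<dim_col A. addcol a k l A $$ (i, j) * w j)"
    using v by (auto simp: in_col_lattice_def)
  have "v i = (\<Sum>j<dim_col A. A $$ (i, j) * (w(l := w l + a * w k)) j)" if i: "i < dim_row A" for i
  proof -
    have "v i = (\<Sum>j<dim_col A. A $$ (i, j) * w j + (if j = k then a * A $$ (i, l) * w k else 0))"
      unfolding w[OF i] using i by (intro sum.cong) (auto simp: algebra_simps)
    also have "\<dots> = (\<Sum>j<dim_col A. A $$ (i, j) * w j) + a * A $$ (i, l) * w k"
      using kl by (simp add: sum.distrib)
    also have "\<dots> = (\<Sum>j<dim_col A. A $$ (i, j) * w j + (if j = l then a * A $$ (i, l) * w k else 0))"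
      using kl by (simp add: sum.distrib)
    also have "\<dots> = (\<Sum>j<dim_col A. A $$ (i, j) * (w(l := w l + a * w k)) j)"
      by (intro sum.cong) (auto simp: algebra_simps)
    finally show ?thesis .
  qed
  then show ?thesis unfolding in_col_lattice_def by blast
qed

text \<open>
  A column addition is undone by the opposite one, so one inclusion of lattices gives both.
\<close>

lemma in_col_lattice_addcol:
  assumes kl: "k \<noteq> l" "k < dim_col A" "l < dim_col A"
  shows "in_col_lattice (addcol a k l A) = in_col_lattice A"
proof
  fix v
  have "addcol (- a) k l (addcol a k l A) = A"
    using kl by (intro eq_matI) auto
  then show "in_col_lattice (addcol a k l A) v = in_col_lattice A v"
    using in_col_lattice_addcol_imp[OF kl, of a v]
      in_col_lattice_addcol_imp[of k l "addcol a k l A" "- a" v] kl by auto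
qed

text \<open>
  Euclid's algorithm on the first row, with column additions only: as long as two entries are nonzero,
  the smaller one reduces the larger one, and the sum of the absolute values decreases.
\<close>

lemma clear_first_row:
  assumes "A \<in> carrier_mat r r" "0 < r"
  shows "\<exists>B \<in> carrier_mat r r. in_col_lattice B = in_col_lattice A \<and> det B = det A \<and>
    (\<forall>j. 0 < j \<and> j < r \<longrightarrow> B $$ (0, j) = 0)"
  using assms
proof (induction "\<Sum>j<r. nat \<bar>A $$ (0, j)\<bar>" arbitrary: A rule: less_induct)
  case less
  note A = less.prems(1)
  show ?case
  proof (cases "\<exists>k l. k < r \<and> l < r \<and> k \<noteq> l \<and> A $$ (0, l) \<noteq> 0 \<and> \<bar>A $$ (0, l)\<bar> \<le> \<bar>A $$ (0, k)\<bar>")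
    case True
    then obtain k l where kl: "k < r" "l < r" "k \<noteq> l" "A $$ (0, l) \<noteq> 0"
      "\<bar>A $$ (0, l)\<bar> \<le> \<bar>A $$ (0, k)\<bar>" by blast
    define a where "a = (if (0 < A $$ (0, l)) = (0 < A $$ (0, k)) then - 1 else 1 :: int)"
    let ?B = "addcol a k l A"
    have B: "?B \<in> carrier_mat r r" using A by auto
    have "(\<Sum>j<r. nat \<bar>?B $$ (0, j)\<bar>) < (\<Sum>j<r. nat \<bar>A $$ (0, j)\<bar>)"
    proof (rule sum_strict_mono_ex1)
      show "\<forall>j\<in>{..<r}. nat \<bar>?B $$ (0, j)\<bar> \<le> nat \<bar>A $$ (0, j)\<bar>"
        using kl A \<open>0 < r\<close> by (auto simp: a_def)
      show "\<exists>j\<in>{..<r}. nat \<bar>?B $$ (0, j)\<bar> < nat \<bar>A $$ (0, j)\<bar>"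
        using kl A \<open>0 < r\<close> by (intro bexI[of _ k]) (auto simp: a_def)
    qed simp
    from less.hyps[OF this B \<open>0 < r\<close>] show ?thesis
      using kl A by (simp add: in_col_lattice_addcol det_addcol[of l r])
  next
    case False
    have zero: "A $$ (0, k) = 0 \<or> A $$ (0, l) = 0" if "k < r" "l < r" "k \<noteq> l" for k l
      using False that by (metis linorder_linear)
    show ?thesis
    proof (cases "\<exists>j. 0 < j \<and> j < r \<and> A $$ (0, j) \<noteq> 0")
      case True
      then obtain j where j: "0 < j" "j < r" "A $$ (0, j) \<noteq> 0" by blast
      \<comment> \<open>The only nonzero entry of the first row moves to the front.\<close>
      let ?B = "addcol (- 1) j 0 (addcol 1 0 j A)"
      have "A $$ (0, i) = 0" if "i < r" "i \<noteq> j" for i using zero[OF that(1) j(2) that(2)] j by blast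
      then have "\<forall>i. 0 < i \<and> i < r \<longrightarrow> ?B $$ (0, i) = 0" using j A by auto
      moreover have "in_col_lattice ?B = in_col_lattice A"
        using j A by (simp add: in_col_lattice_addcol)
      moreover have "det ?B = det A"
      proof -
        have "addcol 1 0 j A \<in> carrier_mat r r" using A by (simp add: mat_addcol_def)
        from det_addcol[OF \<open>0 < r\<close> _ this, of j] det_addcol[OF j(2) _ A, of 0] show ?thesis
          using j(1) by simp
      qed
      ultimately show ?thesis using A by (intro bexI[of _ ?B]) auto
    qed (use A in blast)
  qed
qed

text \<open>
  A set of representatives of all cosets of the column lattice, one for each coset. Vectors are
  functions on all of \<open>nat\<close>, of which only the values below the number of rows count.
\<close>

definition transversal :: "int mat \<Rightarrow> (nat \<Rightarrow> int) set \<Rightarrow> bool" where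
  "transversal A T \<longleftrightarrow> (\<forall>v. \<exists>t\<in>T. in_col_lattice A (\<lambda>i. v i - t i)) \<and>
     (\<forall>t\<in>T. \<forall>t'\<in>T. in_col_lattice A (\<lambda>i. t i - t' i) \<longrightarrow> t = t')"

text \<open>
  The index of a full lattice is the absolute value of its determinant. After clearing the first row
  except for its corner \<open>d\<close>, a representative is determined by a residue modulo \<open>d\<close> in the first
  coordinate and by a representative for the remaining minor, and the determinant factors likewise.
\<close>

lemma transversal_det:
  assumes "A \<in> carrier_mat r r" "det A \<noteq> 0"
  shows "\<exists>T. finite T \<and> int (card T) = \<bar>det A\<bar> \<and> transversal A T"
  using assms
proof (induction r arbitrary: A)
  case 0
  then show ?case
    by (intro exI[of _ "{\<lambda>_. 0}"]) (auto simp: transversal_def in_col_lattice_def)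
next
  case (Suc r)
  obtain B where B: "B \<in> carrier_mat (Suc r) (Suc r)" and BA: "in_col_lattice B = in_col_lattice A"
    "det B = det A" and row: "\<And>j. 0 < j \<Longrightarrow> j < Suc r \<Longrightarrow> B $$ (0, j) = 0"
    using clear_first_row[OF Suc.prems(1)] by auto
  define d where "d = B $$ (0, 0)"
  define c where "c i = B $$ (Suc i, 0)" for i
  define A' where "A' = mat r r (\<lambda>(i, j). B $$ (Suc i, Suc j))"
  have A': "A' \<in> carrier_mat r r" by (simp add: A'_def)
  have "B = four_block_mat (mat 1 1 (\<lambda>_. d)) (0\<^sub>m 1 r) (mat r 1 (\<lambda>(i, j). c i)) A'"
    using B row by (intro eq_matI) (auto simp: d_def c_def A'_def)
  then have "det B = det (mat 1 1 (\<lambda>_. d)) * det A'"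
    using A' det_four_block_mat_upper_right_zero[of "mat 1 1 (\<lambda>_. d)" 1 "0\<^sub>m 1 r" r
        "mat r 1 (\<lambda>(i, j). c i)" A'] by simp
  also have "det (mat 1 1 (\<lambda>_. d)) = d" by (simp add: det_single)
  finally have det: "det A = d * det A'" using BA by simp
  then have d: "d \<noteq> 0" and dA': "det A' \<noteq> 0" using Suc.prems by auto
  have lattice: "in_col_lattice A v \<longleftrightarrow> (\<exists>q. v 0 = d * q \<and> in_col_lattice A' (\<lambda>i. v (Suc i) - c i * q))"
    (is "_ \<longleftrightarrow> ?R") for v
  proof -
    have row0: "(\<Sum>j<Suc r. B $$ (0, j) * w j) = d * w 0" for w
      using row by (simp add: sum.lessThan_Suc_shift d_def del: sum.lessThan_Suc)
    have rowS: "(\<Sum>j<Suc r. B $$ (Suc i, j) * w j) = c i * w 0 + (\<Sum>j<r. A' $$ (i, j) * w (Suc j))"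
      if "i < r" for i w
      using that by (simp add: sum.lessThan_Suc_shift c_def A'_def del: sum.lessThan_Suc)
    have "in_col_lattice A v \<longleftrightarrow> (\<exists>w. v 0 = d * w 0 \<and>
        (\<forall>i<r. v (Suc i) = c i * w 0 + (\<Sum>j<r. A' $$ (i, j) * w (Suc j))))"
      unfolding BA(1)[symmetric] in_col_lattice_def
      using B by (simp add: All_less_Suc2 row0 rowS del: sum.lessThan_Suc)
    also have "\<dots> \<longleftrightarrow> ?R"
    proof
      assume "\<exists>w. v 0 = d * w 0 \<and>
        (\<forall>i<r. v (Suc i) = c i * w 0 + (\<Sum>j<r. A' $$ (i, j) * w (Suc j)))"
      then show ?R using A' unfolding in_col_lattice_def by force
    next
      assume ?R
      then obtain q w where "v 0 = d * q"
        "\<forall>i<r. v (Suc i) - c i * q = (\<Sum>j<r. A' $$ (i, j) * w j)"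
        using A' unfolding in_col_lattice_def by auto
      then show "\<exists>w. v 0 = d * w 0 \<and>
        (\<forall>i<r. v (Suc i) = c i * w 0 + (\<Sum>j<r. A' $$ (i, j) * w (Suc j)))"
        by (intro exI[of _ "case_nat q w"]) (auto simp: algebra_simps)
    qed
    finally show ?thesis .
  qed
  obtain T where T: "finite T" "int (card T) = \<bar>det A'\<bar>" "transversal A' T"
    using Suc.IH[OF A' dA'] by blast
  define T' where "T' = (\<lambda>(i, t). case_nat i t) ` ({0..<\<bar>d\<bar>} \<times> T)"
  have inj: "inj_on (\<lambda>(i, t). case_nat i t :: nat \<Rightarrow> int) ({0..<\<bar>d\<bar>} \<times> T)"
  proof (rule inj_onI, clarify)
    fix i t i' t' assume eq: "case_nat i t = (case_nat i' t' :: nat \<Rightarrow> int)"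
    show "i = i' \<and> t = t'"
      using fun_cong[OF eq, of 0] fun_cong[OF eq, of "Suc _"] by auto
  qed
  have "int (card T') = \<bar>det A\<bar>"
    by (simp add: T'_def card_image[OF inj] card_cartesian_product T(2) det abs_mult)
  moreover have "finite T'" using T(1) by (simp add: T'_def)
  moreover have "transversal A T'"
    unfolding transversal_def
  proof (intro conjI allI ballI impI)
    fix v :: "nat \<Rightarrow> int"
    \<comment> \<open>the quotient that goes with a residue in \<open>{0..<\<bar>d\<bar>}\<close> when \<open>d\<close> may be negative\<close>
    define q where "q = sgn d * (v 0 div \<bar>d\<bar>)"
    have "v 0 = d * q + v 0 mod \<bar>d\<bar>"
    proof -
      have "d * q = \<bar>d\<bar> * (v 0 div \<bar>d\<bar>)" by (simp only: q_def abs_sgn mult.assoc)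
      then show ?thesis by simp
    qed
    moreover obtain t where t: "t \<in> T" "in_col_lattice A' (\<lambda>i. (v (Suc i) - c i * q) - t i)"
      using T(3)[unfolded transversal_def, THEN conjunct1, rule_format, of "\<lambda>i. v (Suc i) - c i * q"]
      by blast
    ultimately have "in_col_lattice A (\<lambda>i. v i - case_nat (v 0 mod \<bar>d\<bar>) t i)"
      unfolding lattice by (intro exI[of _ q]) (simp add: algebra_simps)
    moreover have "case_nat (v 0 mod \<bar>d\<bar>) t \<in> T'"
      using t d by (auto simp: T'_def)
    ultimately show "\<exists>t\<in>T'. in_col_lattice A (\<lambda>i. v i - t i)" by blast
  next
    fix s s' assume "s \<in> T'" "s' \<in> T'" and lat: "in_col_lattice A (\<lambda>i. s i - s' i)"
    then obtain i t i' t' where s: "s = case_nat i t" "s' = case_nat i' t'"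
      "i \<in> {0..<\<bar>d\<bar>}" "i' \<in> {0..<\<bar>d\<bar>}" "t \<in> T" "t' \<in> T"
      by (auto simp: T'_def)
    then obtain q where q: "i - i' = d * q" "in_col_lattice A' (\<lambda>j. (t j - t' j) - c j * q)"
      using lat unfolding lattice by auto
    have "q = 0"
    proof (rule ccontr)
      assume "q \<noteq> 0"
      then have "\<bar>d\<bar> * 1 \<le> \<bar>d\<bar> * \<bar>q\<bar>" by (intro mult_left_mono) auto
      then have "\<bar>d\<bar> \<le> \<bar>i - i'\<bar>" by (simp add: q(1) abs_mult)
      then show False using s(3,4) by auto
    qed
    then have "i = i'" "t = t'"
      using q s(5,6) T(3) by (simp_all add: transversal_def)
    then show "s = s'" using s by simp
  qed
  ultimately show ?case by blast
qed

text \<open>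
  If the determinant vanishes, some nonzero integer functional \<open>u\<close> kills the column lattice. It is
  then constant on cosets but takes infinitely many values, so there are infinitely many cosets.
\<close>

lemma finite_cover_imp_det_nonzero:
  assumes A: "A \<in> carrier_mat r r" and T: "finite T"
    and cover: "\<And>v. \<exists>t\<in>T. in_col_lattice A (\<lambda>i. v i - t i)"
  shows "det A \<noteq> 0"
proof
  assume "det A = 0"
  then have "det (transpose_mat A) = 0" using A by (simp add: det_transpose)
  then obtain u where u: "u \<in> carrier_vec r" "u \<noteq> 0\<^sub>v r" "transpose_mat A *\<^sub>v u = 0\<^sub>v r"
    using det_0_iff_vec_prod_zero[of "transpose_mat A" r] A by auto
  obtain k where k: "k < r" "u $ k \<noteq> 0"
    using u(1,2) by (metis carrier_vecD eq_vecI index_zero_vec)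
  have ortho: "(\<Sum>i<r. A $$ (i, j) * u $ i) = 0" if "j < r" for j
  proof -
    have "(transpose_mat A *\<^sub>v u) $ j = 0" using u(3) that by simp
    then show ?thesis
      using A u(1) that by (simp add: scalar_prod_def atLeast0LessThan)
  qed
  let ?ev = "\<lambda>v. \<Sum>i<r. u $ i * v i"
  have vanish: "?ev v = 0" if v: "in_col_lattice A v" for v
  proof -
    obtain w where "\<And>i. i < r \<Longrightarrow> v i = (\<Sum>j<r. A $$ (i, j) * w j)"
      using v A unfolding in_col_lattice_def by auto
    then have "?ev v = (\<Sum>i<r. \<Sum>j<r. w j * (A $$ (i, j) * u $ i))"
      by (intro sum.cong) (simp_all add: sum_distrib_left mult.commute mult.left_commute)
    also have "\<dots> = (\<Sum>j<r. w j * (\<Sum>i<r. A $$ (i, j) * u $ i))"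
      by (subst sum.swap) (simp only: sum_distrib_left)
    finally show ?thesis by (simp add: ortho)
  qed
  have diff: "?ev (\<lambda>i. a i - b i) = ?ev a - ?ev b" for a b :: "nat \<Rightarrow> int"
    by (simp only: right_diff_distrib sum_subtractf)
  have "u $ k * m \<in> ?ev ` T" for m
  proof -
    let ?v = "\<lambda>i. if i = k then m else 0"
    obtain t where t: "t \<in> T" "in_col_lattice A (\<lambda>i. ?v i - t i)"
      using cover[of ?v] by (elim bexE)
    have "?ev (\<lambda>i. ?v i - t i) = ?ev ?v - ?ev t" by (rule diff)
    moreover have "?ev ?v = u $ k * m"
    proof -
      have "?ev ?v = (\<Sum>i<r. if i = k then u $ k * m else 0)" by (rule sum.cong) auto
      then show ?thesis using k by simp
    qed
    ultimately show ?thesis using vanish[OF t(2)] t(1) by (auto simp: image_iff)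
  qed
  then have "range (\<lambda>m. u $ k * m) \<subseteq> ?ev ` T" by blast
  moreover have "infinite (range (\<lambda>m. u $ k * m))"
    using k by (subst finite_image_iff) (auto simp: inj_def infinite_UNIV_int)
  ultimately show False using T by (meson finite_imageI finite_subset)
qed

section \<open>Incidence numbers and lists of cells\<close>

definition incidence :: "face \<Rightarrow> face \<Rightarrow> int" where
  "incidence F G = Poly_Mapping.lookup (cell_boundary F) G"

lemma lookup_prefix_chain:
  "Poly_Mapping.lookup (prefix_chain a c) (b # G) = (if a = b then Poly_Mapping.lookup c G else 0)"
  "Poly_Mapping.lookup (prefix_chain a c) [] = 0"
  by (induction c rule: frag_induction[OF subset_UNIV, case_names zero one diff])
    (auto simp: frag_extend_diff lookup_minus lookup_single when_def)

lemma incidence_Nil [simp]: "incidence [] G = 0" "incidence F [] = 0"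
proof -
  show "incidence [] G = 0" by (simp add: incidence_def cell_boundary_Nil)
  show "incidence F [] = 0"
    by (cases F) (auto simp: incidence_def cell_boundary_Nil cell_boundary_Cons lookup_minus
        lookup_prefix_chain lookup_single)
qed

lemma incidence_Cons:
  "incidence (a # F) (c # G) =
    (if a = Star then
       (case c of One \<Rightarrow> if F = G then 1 else 0 | Zero \<Rightarrow> if F = G then - 1 else 0 | Star \<Rightarrow> - incidence F G)
     else if a = c then incidence F G else 0)"
  by (cases c) (auto simp: incidence_def cell_boundary_Cons lookup_minus lookup_prefix_chain
      lookup_single when_def)

lemma face_dim_Nil [simp]: "face_dim [] = 0"
  by (simp add: face_dim_def)

lemma face_dim_Cons [simp]: "face_dim (a # F) = (if a = Star then Suc (face_dim F) else face_dim F)"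
proof -
  have *: "face_dim F = length (filter (\<lambda>a. a = Star) F)" for F
    by (simp add: face_dim_def length_filter_conv_card)
  show ?thesis unfolding * by simp
qed

lemma incidence_nonzero_imp:
  "incidence F G \<noteq> 0 \<Longrightarrow> length F = length G \<and> face_dim F = Suc (face_dim G)"
proof (induction F arbitrary: G)
  case (Cons a F)
  show ?case
  proof (cases G)
    case (Cons c G')
    then show ?thesis
      using Cons.prems Cons.IH[of G'] by (cases c) (auto simp: incidence_Cons split: if_splits)
  qed (use Cons.prems in simp)
qed simp

text \<open>
  The recursions split off the first factor of a face. A face other than the vertex \<open>(0, \<dots>, 0)\<close> has a
  first factor different from \<open>Zero\<close>: \<open>one_list n p\<close> collects the \<open>p\<close>-cells for which it is \<open>One\<close>, and
  \<open>star_list n p\<close> the \<open>(p + 1)\<close>-cells for which it is \<open>Star\<close>. Changing this factor from \<open>One\<close> to \<open>Star\<close>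
  pairs the two lists entry by entry; this is an acyclic matching of the cube, with the vertex
  \<open>(0, \<dots>, 0)\<close> as its only unmatched cell.
\<close>

fun cell_list :: "nat \<Rightarrow> nat \<Rightarrow> face list" where
  "cell_list 0 p = (if p = 0 then [[]] else [])"
| "cell_list (Suc n) p = (map ((#) Zero) (cell_list n p) @ map ((#) One) (cell_list n p)) @
     (case p of 0 \<Rightarrow> [] | Suc q \<Rightarrow> map ((#) Star) (cell_list n q))"

fun one_list :: "nat \<Rightarrow> nat \<Rightarrow> face list" where
  "one_list 0 p = []"
| "one_list (Suc n) p = map ((#) One) (cell_list n p) @ map ((#) Zero) (one_list n p)"

fun star_list :: "nat \<Rightarrow> nat \<Rightarrow> face list" where
  "star_list 0 p = []"
| "star_list (Suc n) p = map ((#) Star) (cell_list n p) @ map ((#) Zero) (star_list n p)"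

lemma set_cell_list: "set (cell_list n p) = cells (cube n) p"
proof (induction n arbitrary: p)
  case 0
  then show ?case by (auto simp: cells_def cube_def)
next
  case (Suc n)
  have "F \<in> set (cell_list (Suc n) p) \<longleftrightarrow> F \<in> cells (cube (Suc n)) p" for F
  proof (cases F)
    case Nil
    then show ?thesis by (auto simp: cells_def cube_def split: nat.split)
  next
    case (Cons a G)
    then show ?thesis
      by (cases a) (auto simp: Suc.IH cells_def cube_def image_iff split: nat.split)
  qed
  then show ?case by blast
qed

lemma distinct_cell_list: "distinct (cell_list n p)"
  by (induction n arbitrary: p) (auto simp: distinct_map split: nat.split)

lemma length_star_list [simp]: "length (star_list n p) = length (one_list n p)"
  by (induction n) auto

lemma set_one_list_subset: "set (one_list n p) \<subseteq> cells (cube n) p"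
  by (induction n) (auto simp: set_cell_list, auto simp: cells_def cube_def)

lemma set_star_list_subset: "set (star_list n p) \<subseteq> cells (cube n) (Suc p)"
  by (induction n) (auto simp: set_cell_list, auto simp: cells_def cube_def)

lemma distinct_one_list: "distinct (one_list n p)"
  by (induction n) (auto simp: distinct_map distinct_cell_list)

lemma distinct_star_list: "distinct (star_list n p)"
  by (induction n) (auto simp: distinct_map distinct_cell_list)

lemma one_star_disjoint: "set (one_list n p) \<inter> set (star_list n q) = {}"
  by (induction n) auto

lemma set_one_star_list: "set (one_list n (Suc p)) \<union> set (star_list n p) = cells (cube n) (Suc p)"
  unfolding set_cell_list[symmetric] by (induction n) auto

lemma distinct_one_star: "distinct (one_list n p @ star_list n q)"
  by (simp add: distinct_one_list distinct_star_list one_star_disjoint)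

lemma card_cells_cube:
  "card (cells (cube n) (Suc p)) = length (one_list n (Suc p)) + length (one_list n p)"
  using distinct_card[OF distinct_one_star[of n "Suc p" p]] by (simp add: set_one_star_list)

lemma one_list_eq_Nil: "n \<le> p \<Longrightarrow> one_list n p = []"
proof (induction n)
  case (Suc n)
  have "cell_list n p = []" if "n < p" for n p
    using that by (induction n arbitrary: p) (auto split: nat.split)
  then show ?case using Suc by simp
qed simp

lemma one_list_nonempty: "p < n \<Longrightarrow> one_list n p \<noteq> []"
proof (induction n)
  case (Suc n)
  have "cell_list n p \<noteq> []" if "p \<le> n" for n p
    using that by (induction n arbitrary: p) (auto split: nat.split)
  then show ?case using Suc by simp
qed simp

lemma finite_cube: "finite (cube n)"
proof -
  have "(UNIV :: side set) = {Zero, One, Star}" using side.exhaust by blast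
  then have "finite (UNIV :: side set)" by (metis finite.emptyI finite.insertI)
  then show ?thesis
    using finite_lists_length_eq[of "UNIV :: side set" n] by (simp add: cube_def)
qed

lemma finite_cells_cube [simp]: "finite (cells (cube n) p)"
  using finite_cube by (simp add: cells_def)

text \<open>
  With respect to the matching, the boundary map is unitriangular: besides the partner of a cell of
  \<open>star_list\<close>, its boundary only meets cells of \<open>one_list\<close> whose first nonzero factor comes later.
\<close>

lemma det_incidence_one_star:
  "det (list_mat (one_list n p) (star_list n p) (\<lambda>e a. incidence a e)) = 1"
proof (induction n)
  case (Suc n)
  show ?case unfolding one_list.simps star_list.simps
    by (subst det_list_mat_block_lower)
      (auto simp: incidence_Cons list_mat_map Suc.IH distinct_cell_list eq_commute[of _ "_ :: face"]
        list_mat_one)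
qed simp

section \<open>The spectrum of the Laplacian\<close>

text \<open>
  The matrix of \<open>\<partial>\<partial>\<^sup>T + \<partial>\<^sup>T\<partial>\<close>. The sums may run over cells of all dimensions because incidence numbers
  vanish unless the dimensions differ by one.
\<close>

definition laplacian :: "nat \<Rightarrow> face \<Rightarrow> face \<Rightarrow> int" where
  "laplacian n F G = (\<Sum>H\<in>cube n. incidence H F * incidence H G + incidence F H * incidence G H)"

lemma sum_cube_Suc:
  "(\<Sum>H\<in>cube (Suc n). f H) = (\<Sum>H\<in>cube n. f (Zero # H)) + (\<Sum>H\<in>cube n. f (One # H)) + (\<Sum>H\<in>cube n. f (Star # H))"
proof -
  have cube: "cube (Suc n) = (#) Zero ` cube n \<union> (#) One ` cube n \<union> (#) Star ` cube n"
  proof (rule Set.set_eqI)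
    fix F show "F \<in> cube (Suc n) \<longleftrightarrow> F \<in> (#) Zero ` cube n \<union> (#) One ` cube n \<union> (#) Star ` cube n"
    proof (cases F)
      case (Cons a G)
      then show ?thesis by (cases a) (auto simp: cube_def)
    qed (auto simp: cube_def)
  qed
  show ?thesis
    unfolding cube
    by (subst sum.union_disjoint; (subst sum.union_disjoint)?)
      (auto simp: finite_cube sum.reindex)
qed

text \<open>
  The Laplacian of the unit interval.
\<close>

definition side_laplacian :: "side \<Rightarrow> side \<Rightarrow> int" where
  "side_laplacian a b = (if a = b then if a = Star then 2 else 1 else if a = Star \<or> b = Star then 0 else - 1)"

text \<open>
  The Laplacian of a product complex is the sum of the Laplacians of the factors: the mixed terms of the
  upper and the lower half cancel by the sign rule for product cells.
\<close>

lemma laplacian_Cons: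
  assumes "F \<in> cube n" "G \<in> cube n"
  shows "laplacian (Suc n) (a # F) (b # G) =
    (if a = b then laplacian n F G else 0) + (if F = G then side_laplacian a b else 0)"
proof -
  have delta: "(\<Sum>H\<in>cube n. (if H = X then c H else 0)) = c X"
      "(\<Sum>H\<in>cube n. (if X = H then c H else 0)) = c X" if "X \<in> cube n" for X and c :: "face \<Rightarrow> int"
    using that finite_cube by simp_all
  have mult: "(if P then x else 0) * y = (if P then x * y else 0)"
      "y * (if P then x else 0) = (if P then y * x else 0)" for P and x y :: int by auto
  show ?thesis
    unfolding laplacian_def sum_cube_Suc
    by (cases a; cases b)
      (use assms in \<open>simp_all add: incidence_Cons sum.distrib mult delta side_laplacian_def sum_negf\<close>)
qed

text \<open>
  Subtracting the first block row from the second and adding the second block column to the first makes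
  the matrix block triangular.
\<close>

lemma det_block_circulant:
  fixes A B :: "'a :: idom mat"
  assumes A: "A \<in> carrier_mat m m" and B: "B \<in> carrier_mat m m"
  shows "det (four_block_mat A B B A) = det (A + B) * det (A - B)"
proof -
  let ?I = "1\<^sub>m m :: 'a mat" and ?O = "0\<^sub>m m m :: 'a mat"
  let ?P = "four_block_mat ?I ?O (- ?I) ?I" and ?Q = "four_block_mat ?I ?O ?I ?I"
  let ?M = "four_block_mat A B B A"
  have I: "?I \<in> carrier_mat m m" and O: "?O \<in> carrier_mat m m" and mI: "- ?I \<in> carrier_mat m m"
    by auto
  have "?M * ?Q = four_block_mat (A + B) B (B + A) A"
    using A B by (subst mult_four_block_mat[OF A B B A I O I I]) simp
  also have "?P * \<dots> = four_block_mat (A + B) B ?O (A - B)"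
    using A B
    by (subst mult_four_block_mat[OF I O mI I]) (auto intro!: cong_four_block_mat eq_matI)
  finally have eq: "?P * (?M * ?Q) = four_block_mat (A + B) B ?O (A - B)" .
  have dets: "det ?P = 1" "det ?Q = 1"
    using det_four_block_mat_upper_right_zero[OF I refl mI I]
      det_four_block_mat_upper_right_zero[OF I refl I I] by simp_all
  have carr: "?P \<in> carrier_mat (m + m) (m + m)" "?M \<in> carrier_mat (m + m) (m + m)"
    "?Q \<in> carrier_mat (m + m) (m + m)"
    using A B by auto
  have "det ?M = det (?P * (?M * ?Q))"
    using carr by (simp add: det_mult[of _ "m + m"] dets)
  also have "\<dots> = det (A + B) * det (A - B)"
    unfolding eq using A B by (intro det_four_block_mat_lower_left_zero) auto
  finally show ?thesis .
qed

text \<open>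
  On each pair of opposite facets the interval Laplacian has the eigenvalues \<open>0\<close> and \<open>2\<close>, and on cells
  along the first direction it is \<open>2\<close>. Hence the characteristic polynomial for \<open>n + 1\<close> is a product of
  those for \<open>n\<close> with \<open>x\<close> kept or shifted by \<open>2\<close>, and Pascal's rule collects the exponents. In other
  words, on \<open>p\<close>-cells the Laplacian has the eigenvalue \<open>2j\<close> with multiplicity
  \<open>binom(n, j) binom(j, p)\<close>.
\<close>

theorem det_laplacian:
  "det (list_mat (cell_list n p) (cell_list n p) (\<lambda>F G. laplacian n F G + (if F = G then x else 0)))
    = (\<Prod>j\<le>n. (x + 2 * int j) ^ ((n choose j) * (j choose p)))"
  (is "?D n p x = ?P n p x")
proof (induction n arbitrary: p x)
  case 0
  then show ?case by (cases p) (auto simp: laplacian_def cube_def)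
next
  case (Suc n)
  let ?c = "cell_list n p"
  let ?f = "\<lambda>x F G. laplacian n F G + (if F = G then x else 0)"
  let ?F = "\<lambda>F G. laplacian (Suc n) F G + (if F = G then x else 0)"
  let ?xs = "map ((#) Zero) ?c @ map ((#) One) ?c"
  let ?zs = "case p of 0 \<Rightarrow> [] | Suc q \<Rightarrow> map ((#) Star) (cell_list n q)"
  have cube: "F \<in> cube n" if "F \<in> set (cell_list n p)" for F p
    using that by (simp add: set_cell_list cells_def)
  have "det (list_mat ?xs ?xs ?F) = ?D n p x * ?D n p (x + 2)"
  proof -
    let ?A = "list_mat ?c ?c (?f (x + 1))" and ?B = "list_mat ?c ?c (\<lambda>F G. if F = G then - 1 else 0 :: int)"
    have blocks: "list_mat ?xs ?xs ?F = four_block_mat ?A ?B ?B ?A"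
      unfolding list_mat_append list_mat_map
      by (intro cong_four_block_mat list_mat_cong)
        (simp_all add: laplacian_Cons cube side_laplacian_def)
    have "det (list_mat ?xs ?xs ?F) = det (?A + ?B) * det (?A - ?B)"
      unfolding blocks by (rule det_block_circulant) (rule list_mat_carrier)+
    moreover have "?A + ?B = list_mat ?c ?c (?f x)"
      unfolding list_mat_add by (rule list_mat_cong) simp
    moreover have "?A - ?B = list_mat ?c ?c (?f (x + 2))"
      unfolding list_mat_diff by (rule list_mat_cong) simp
    ultimately show ?thesis by (simp only:)
  qed
  moreover have "det (list_mat ?zs ?zs ?F) = (case p of 0 \<Rightarrow> 1 | Suc q \<Rightarrow> ?D n q (x + 2))"
  proof (cases p)
    case (Suc q)
    have "list_mat ?zs ?zs ?F = list_mat (cell_list n q) (cell_list n q) (?f (x + 2))"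
      unfolding Suc nat.case list_mat_map
      by (intro list_mat_cong) (simp add: laplacian_Cons cube side_laplacian_def)
    then show ?thesis using Suc by simp
  qed simp
  moreover have "?D (Suc n) p x = det (list_mat ?xs ?xs ?F) * det (list_mat ?zs ?zs ?F)"
    unfolding cell_list.simps
    by (rule det_list_mat_block_lower)
      (auto simp: laplacian_Cons cube side_laplacian_def split: nat.splits if_splits)
  ultimately have "?D (Suc n) p x =
      ?P n p x * ?P n p (x + 2) * (case p of 0 \<Rightarrow> 1 | Suc q \<Rightarrow> ?P n q (x + 2))"
    by (simp add: Suc.IH split: nat.split)
  also have "\<dots> = ?P (Suc n) p x"
  proof -
    have "?P (Suc n) p x = (\<Prod>j\<le>Suc n. (x + 2 * int j) ^ ((n choose j) * (j choose p))) *
       (\<Prod>j\<le>Suc n. (x + 2 * int j) ^ ((case j of 0 \<Rightarrow> 0 | Suc i \<Rightarrow> n choose i) * (j choose p)))"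
      unfolding prod.distrib[symmetric] power_add[symmetric]
      by (intro prod.cong) (auto simp: algebra_simps split: nat.split)
    also have "(\<Prod>j\<le>Suc n. (x + 2 * int j) ^ ((n choose j) * (j choose p))) = ?P n p x"
      by (simp add: binomial_eq_0[OF lessI])
    also have "(\<Prod>j\<le>Suc n. (x + 2 * int j) ^ ((case j of 0 \<Rightarrow> 0 | Suc i \<Rightarrow> n choose i) * (j choose p)))
       = (\<Prod>j\<le>n. (x + 2 + 2 * int j) ^ ((n choose j) * (Suc j choose p)))"
      by (simp add: prod.atMost_Suc_shift algebra_simps del: prod.atMost_Suc)
    also have "\<dots> = ?P n p (x + 2) * (case p of 0 \<Rightarrow> 1 | Suc q \<Rightarrow> ?P n q (x + 2))"
    proof (cases p)
      case (Suc q)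
      then show ?thesis
        by (simp add: algebra_simps power_add prod.distrib)
    qed simp
    finally show ?thesis by (simp add: mult.assoc)
  qed
  finally show ?case .
qed

section \<open>The cellular chain complex in coordinates\<close>

lemma lookup_bd:
  assumes "finite S" "Poly_Mapping.keys c \<subseteq> S"
  shows "Poly_Mapping.lookup (bd c) H = (\<Sum>G\<in>S. Poly_Mapping.lookup c G * incidence G H)"
proof -
  have "Poly_Mapping.lookup (bd c) H
      = (\<Sum>G\<in>Poly_Mapping.keys c. Poly_Mapping.lookup c G * incidence G H)"
    by (simp add: bd_def frag_extend_def lookup_sum incidence_def)
  also have "\<dots> = (\<Sum>G\<in>S. Poly_Mapping.lookup c G * incidence G H)"
    using assms by (intro sum.mono_neutral_left) (auto simp: in_keys_iff)
  finally show ?thesis .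
qed

lemma incidence_cells:
  assumes "F \<in> cells (cube n) p" "incidence F G \<noteq> 0"
  shows "0 < p" "G \<in> cells (cube n) (p - 1)"
  using incidence_nonzero_imp[OF assms(2)] assms(1) by (auto simp: cells_def cube_def)

lemma coincidence_cells:
  assumes "G \<in> cells (cube n) p" "incidence F G \<noteq> 0"
  shows "F \<in> cells (cube n) (Suc p)"
  using incidence_nonzero_imp[OF assms(2)] assms(1) by (auto simp: cells_def cube_def)

lemma incidence_same_dim:
  assumes "F \<in> cells (cube n) p" "G \<in> cells (cube n) q" "p \<noteq> Suc q"
  shows "incidence F G = 0"
  using incidence_nonzero_imp[of F G] assms by (auto simp: cells_def)

lemma sum_incidence_incidence:
  assumes F: "F \<in> cells (cube n) (Suc (Suc p))"
  shows "(\<Sum>G\<in>cells (cube n) (Suc p). incidence F G * incidence G H) = 0"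
proof -
  have "Poly_Mapping.keys (cell_boundary F) \<subseteq> cells (cube n) (Suc p)"
    using incidence_cells[OF F] by (force simp: incidence_def in_keys_iff)
  then show ?thesis
    using lookup_bd[of "cells (cube n) (Suc p)" "cell_boundary F" H]
    by (simp add: bd_cell_boundary incidence_def)
qed

lemma laplacian_on_cells:
  assumes "F \<in> cells (cube n) (Suc p)" "G \<in> cells (cube n) (Suc p)"
  shows "laplacian n F G = (\<Sum>H\<in>cells (cube n) (Suc (Suc p)). incidence H F * incidence H G)
     + (\<Sum>H\<in>cells (cube n) p. incidence F H * incidence G H)"
proof -
  have "(\<Sum>H\<in>cube n. incidence H F * incidence H G)
      = (\<Sum>H\<in>cells (cube n) (Suc (Suc p)). incidence H F * incidence H G)"
    using coincidence_cells[OF assms(1)]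
    by (intro sum.mono_neutral_right) (auto simp: finite_cube, auto simp: cells_def)
  moreover have "(\<Sum>H\<in>cube n. incidence F H * incidence G H)
      = (\<Sum>H\<in>cells (cube n) p. incidence F H * incidence G H)"
    using incidence_cells[OF assms(1)]
    by (intro sum.mono_neutral_right) (auto simp: finite_cube, auto simp: cells_def)
  ultimately show ?thesis by (simp add: laplacian_def sum.distrib)
qed

lemma list_mat_ex:
  assumes "A \<in> carrier_mat (length xs) (length ys)" "distinct xs" "distinct ys"
  shows "\<exists>f. A = list_mat xs ys f"
proof -
  let ?ix = "\<lambda>zs. the_inv_into {..<length zs} ((!) zs)"
  have ix: "?ix zs (zs ! i) = i" if "distinct zs" "i < length zs" for zs :: "'z list" and i
    using that by (intro the_inv_into_f_f) (auto simp: inj_on_nth)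
  have "A = list_mat xs ys (\<lambda>x y. A $$ (?ix xs x, ?ix ys y))"
    using assms by (intro eq_matI) (auto simp: ix)
  then show ?thesis by blast
qed

lemma det_one_inverse:
  fixes A :: "'a :: comm_ring_1 mat"
  assumes A: "A \<in> carrier_mat r r" and "det A = 1"
  shows "\<exists>B \<in> carrier_mat r r. A * B = 1\<^sub>m r \<and> B * A = 1\<^sub>m r \<and> det B = 1"
proof (intro bexI[of _ "adj_mat A"] conjI)
  show eq: "A * adj_mat A = 1\<^sub>m r" "adj_mat A * A = 1\<^sub>m r"
    using adj_mat[OF A] assms by (simp_all add: smult_mat_def) (auto intro!: eq_matI)
  show B: "adj_mat A \<in> carrier_mat r r" using adj_mat[OF A] by simp
  show "det (adj_mat A) = 1"
    using det_mult[OF A B] eq assms by simp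
qed

text \<open>
  Unimodularity of the matching block provides an integral inverse \<open>v\<close>, with its two indices in the
  order of the block itself.
\<close>

lemma one_star_inverse:
  obtains v where
    "det (list_mat (one_list n p) (star_list n p) v) = 1"
    "\<And>e e'. e \<in> set (one_list n p) \<Longrightarrow> e' \<in> set (one_list n p) \<Longrightarrow>
      (\<Sum>a\<in>set (star_list n p). incidence a e * v e' a) = (if e = e' then 1 else 0)"
    "\<And>a a'. a \<in> set (star_list n p) \<Longrightarrow> a' \<in> set (star_list n p) \<Longrightarrow>
      (\<Sum>e\<in>set (one_list n p). v e a * incidence a' e) = (if a = a' then 1 else 0)"
proof -
  let ?E = "one_list n p" and ?A = "star_list n p"
  let ?U = "list_mat ?E ?A (\<lambda>e a. incidence a e)"
  have U: "?U \<in> carrier_mat (length ?E) (length ?E)"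
    by (simp add: carrier_matI)
  obtain B where B: "B \<in> carrier_mat (length ?E) (length ?E)" "?U * B = 1\<^sub>m (length ?E)"
    "B * ?U = 1\<^sub>m (length ?E)" "det B = 1"
    using det_one_inverse[OF U det_incidence_one_star] by blast
  obtain w where w: "B = list_mat ?A ?E w"
    using list_mat_ex[of B ?A ?E] B(1) by (auto simp: distinct_one_list distinct_star_list)
  define v where "v e a = w a e" for e a
  have entry: "f x y = (if x = y then 1 else 0)"
    if one: "list_mat xs xs f = 1\<^sub>m (length xs)" "distinct xs" and xy: "x \<in> set xs" "y \<in> set xs"
    for f :: "face \<Rightarrow> face \<Rightarrow> int" and xs x y
  proof -
    obtain i j where "i < length xs" "xs ! i = x" "j < length xs" "xs ! j = y"
      using xy by (meson in_set_conv_nth)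
    then show ?thesis
      using arg_cong[OF one(1), of "\<lambda>M. M $$ (i, j)"] one(2) by (auto simp: nth_eq_iff_index_eq)
  qed
  show ?thesis
  proof (rule that[of v])
    have "list_mat ?E ?A v = transpose_mat B"
      unfolding w transpose_list_mat by (rule list_mat_cong) (simp add: v_def)
    then show "det (list_mat ?E ?A v) = 1" using B by (simp add: det_transpose)
    show "(\<Sum>a\<in>set ?A. incidence a e * v e' a) = (if e = e' then 1 else 0)"
      if "e \<in> set ?E" "e' \<in> set ?E" for e e'
      using entry[OF _ distinct_one_list that] B(2)
      by (simp add: w v_def list_mat_mult[OF distinct_star_list])
    show "(\<Sum>e\<in>set ?E. v e a * incidence a' e) = (if a = a' then 1 else 0)"
      if "a \<in> set ?A" "a' \<in> set ?A" for a a'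
      using entry[OF _ distinct_star_list that] B(3)
      by (simp add: w v_def list_mat_mult[OF distinct_one_list])
  qed
qed

text \<open>
  A cycle \<open>z\<close> with vanishing \<open>one_list\<close> coordinates is supported on \<open>star_list\<close>, where the boundary map is
  injective.
\<close>

lemma cycle_eq_0:
  assumes zero: "\<And>e. e \<in> set (one_list n (Suc p)) \<Longrightarrow> z e = 0"
    and cycle: "\<And>H. H \<in> cells (cube n) p \<Longrightarrow> (\<Sum>G\<in>cells (cube n) (Suc p). z G * incidence G H) = 0"
    and G: "G \<in> cells (cube n) (Suc p)"
  shows "z G = (0 :: int)"
proof (cases "G \<in> set (one_list n (Suc p))")
  case False
  then have G': "G \<in> set (star_list n p)" using G set_one_star_list[of n p] by blast
  obtain v where v: "\<And>a a'. a \<in> set (star_list n p) \<Longrightarrow> a' \<in> set (star_list n p) \<Longrightarrow>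
      (\<Sum>e\<in>set (one_list n p). v e a * incidence a' e) = (if a = a' then 1 else 0)"
    using one_star_inverse[of n p] by metis
  have z: "(\<Sum>a\<in>set (star_list n p). z a * incidence a e) = 0" if "e \<in> set (one_list n p)" for e
  proof -
    have "(\<Sum>a\<in>set (star_list n p). z a * incidence a e)
        = (\<Sum>G\<in>cells (cube n) (Suc p). z G * incidence G e)"
      using zero set_star_list_subset[of n p] set_one_star_list[of n p, symmetric]
      by (intro sum.mono_neutral_left) auto
    then show ?thesis using cycle[of e] that set_one_list_subset[of n p] by auto
  qed
  have "z G = (\<Sum>a\<in>set (star_list n p). z a * (\<Sum>e\<in>set (one_list n p). v e G * incidence a e))"
    using G' by (simp add: v if_distrib[of "\<lambda>c. _ * c"] cong: if_cong)
  also have "\<dots> = (\<Sum>a\<in>set (star_list n p). \<Sum>e\<in>set (one_list n p). v e G * (z a * incidence a e))"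
    by (simp add: sum_distrib_left mult.left_commute)
  also have "\<dots> = (\<Sum>e\<in>set (one_list n p). v e G * (\<Sum>a\<in>set (star_list n p). z a * incidence a e))"
    by (subst sum.swap) (simp only: sum_distrib_left)
  finally show ?thesis using z by simp
qed (rule zero)

section \<open>Tree determinants\<close>

definition split_cells :: "nat \<Rightarrow> nat \<Rightarrow> face list" where
  "split_cells n p = one_list n (Suc p) @ star_list n p"

lemma set_split_cells [simp]: "set (split_cells n p) = cells (cube n) (Suc p)"
  by (simp add: split_cells_def set_one_star_list)

lemma distinct_split_cells: "distinct (split_cells n p)"
  unfolding split_cells_def by (rule distinct_one_star)

text \<open>
  With rows restricted to \<open>one_list n p\<close>, the boundary map from \<open>(p + 1)\<close>-cells becomes a matrix \<open>D\<close> that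
  expresses boundaries in integral coordinates for the lattice of reduced \<open>p\<close>-cycles, and \<open>tree_det\<close> is
  \<open>det (D D\<^sup>T)\<close>. On the other hand, the boundaries of the cells in \<open>star_list n p\<close> form a basis of the
  reduced \<open>p\<close>-cycles, and \<open>cycle_gram\<close> is its Gram determinant.
\<close>

definition tree_det :: "nat \<Rightarrow> nat \<Rightarrow> int" where
  "tree_det n p = det (list_mat (one_list n p) (one_list n p)
     (\<lambda>e e'. \<Sum>c\<in>cells (cube n) (Suc p). incidence c e * incidence c e'))"

definition cycle_gram :: "nat \<Rightarrow> nat \<Rightarrow> int" where
  "cycle_gram n p = det (list_mat (star_list n p) (star_list n p)
     (\<lambda>a a'. \<Sum>c\<in>cells (cube n) p. incidence a c * incidence a' c))"

lemma tree_det_cauchy_binet: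
  "tree_det n p = (\<Sum>S | S \<subseteq> cells (cube n) (Suc p) \<and> card S = length (one_list n p).
     (det (list_mat (one_list n p) (enum_set S) (\<lambda>e c. incidence c e)))\<^sup>2)"
  unfolding tree_det_def cauchy_binet[OF finite_cells_cube]
proof (rule sum.cong[OF refl])
  fix S assume S: "S \<in> {S. S \<subseteq> cells (cube n) (Suc p) \<and> card S = length (one_list n p)}"
  then have "finite S" using finite_subset[OF _ finite_cells_cube] by blast
  then have "length (enum_set S) = length (one_list n p)" using S by (simp add: enum_set)
  then have "det (list_mat (enum_set S) (one_list n p) incidence)
      = det (list_mat (one_list n p) (enum_set S) (\<lambda>e c. incidence c e))"
    using det_transpose[of "list_mat (enum_set S) (one_list n p) incidence" "length (one_list n p)"]
    by (simp add: carrier_matI)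
  then show "det (list_mat (one_list n p) (enum_set S) (\<lambda>e c. incidence c e))
      * det (list_mat (enum_set S) (one_list n p) incidence)
      = (det (list_mat (one_list n p) (enum_set S) (\<lambda>e c. incidence c e)))\<^sup>2"
    by (simp add: power2_eq_square)
qed

text \<open>
  The square is the Gram determinant of the columns, which does not depend on their order.
\<close>

lemma det_square_column_order:
  fixes f :: "'a \<Rightarrow> 'b \<Rightarrow> 'c :: comm_ring_1"
  assumes "distinct xs" "distinct ys" "distinct zs" "set ys = set zs" "length xs = length ys"
  shows "(det (list_mat xs ys f))\<^sup>2 = (det (list_mat xs zs f))\<^sup>2"
proof -
  have len: "length zs = length ys" using assms distinct_card by metis
  have sq: "(det (list_mat xs us f))\<^sup>2 = det (list_mat us us (\<lambda>y y'. \<Sum>x\<in>set xs. f x y * f x y'))"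
    if "length us = length xs" for us
  proof -
    have carr: "list_mat xs us f \<in> carrier_mat (length us) (length us)"
      using that by (simp add: carrier_matI)
    have "(det (list_mat xs us f))\<^sup>2 = det (transpose_mat (list_mat xs us f) * list_mat xs us f)"
      using carr by (subst det_mult[of _ "length us"])
        (auto simp: det_transpose[OF carr] power2_eq_square simp del: transpose_list_mat)
    then show ?thesis by (simp add: list_mat_mult[OF assms(1)])
  qed
  show ?thesis
    using assms len by (simp add: sq det_list_mat_reorder[of ys zs])
qed

text \<open>
  In the Cauchy--Binet expansion the set of cells in \<open>star_list n p\<close> contributes \<open>1\<close>.
\<close>

lemma tree_det_pos: "0 < tree_det n p"
proof -
  let ?S = "set (star_list n p)"
  let ?h = "\<lambda>S. (det (list_mat (one_list n p) (enum_set S) (\<lambda>e c. incidence c e)))\<^sup>2"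
  have "?h ?S = (det (list_mat (one_list n p) (star_list n p) (\<lambda>e c. incidence c e)))\<^sup>2"
    by (rule det_square_column_order)
      (auto simp: enum_set distinct_one_list distinct_star_list distinct_card)
  then have one: "?h ?S = 1" by (simp add: det_incidence_one_star)
  have "?h ?S \<le> tree_det n p"
    unfolding tree_det_cauchy_binet
    by (rule member_le_sum) (auto simp: set_star_list_subset distinct_card distinct_star_list)
  with one show ?thesis by simp
qed

text \<open>
  The entries of \<open>\<partial> + \<partial>\<^sup>T\<close>. In the frame below, the columns indexed by \<open>star_list\<close> are the basis of
  the \<open>(p + 1)\<close>-cycles, and those indexed by \<open>one_list\<close> are the rows of \<open>D\<close>, a basis of the orthogonal
  complement of the cycles. In the dual frame, the upper rows read off \<open>one_list\<close> coordinates and the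
  lower rows are those of \<open>D\<close>.
\<close>

definition dirac :: "face \<Rightarrow> face \<Rightarrow> int" where
  "dirac c x = incidence x c + incidence c x"

definition cycle_frame :: "nat \<Rightarrow> nat \<Rightarrow> int mat" where
  "cycle_frame n p = list_mat (split_cells n p) (star_list n (Suc p) @ one_list n p) dirac"

definition dual_frame :: "nat \<Rightarrow> nat \<Rightarrow> int mat" where
  "dual_frame n p = list_mat (one_list n (Suc p) @ one_list n p) (split_cells n p)
     (\<lambda>x c. (if x = c then 1 else 0) + incidence c x)"

lemma in_listsD:
  "e \<in> set (one_list n p) \<Longrightarrow> e \<in> cells (cube n) p"
  "a \<in> set (star_list n p) \<Longrightarrow> a \<in> cells (cube n) (Suc p)"
  using set_one_list_subset set_star_list_subset by blast+

lemma cells_disjoint: "x \<in> cells Y p \<Longrightarrow> y \<in> cells Y q \<Longrightarrow> p \<noteq> q \<Longrightarrow> x \<noteq> y"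
  by (auto simp: cells_def)

lemma dirac_upper: "c \<in> cells (cube n) p \<Longrightarrow> x \<in> cells (cube n) (Suc p) \<Longrightarrow> dirac c x = incidence x c"
  by (simp add: dirac_def incidence_same_dim)

lemma dirac_lower: "c \<in> cells (cube n) (Suc p) \<Longrightarrow> x \<in> cells (cube n) p \<Longrightarrow> dirac c x = incidence c x"
  by (simp add: dirac_def incidence_same_dim)

lemma det_dual_frame: "det (dual_frame n p) = 1"
proof -
  have "list_mat (one_list n (Suc p)) (one_list n (Suc p))
      (\<lambda>x c. (if x = c then 1 else 0) + incidence c x) = 1\<^sub>m (length (one_list n (Suc p)))"
    unfolding list_mat_one[OF distinct_one_list, symmetric]
    by (rule list_mat_cong) (auto simp: incidence_same_dim dest!: in_listsD)
  moreover have "list_mat (one_list n p) (star_list n p)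
      (\<lambda>x c. (if x = c then 1 else 0) + incidence c x)
      = list_mat (one_list n p) (star_list n p) (\<lambda>e a. incidence a e)"
    by (rule list_mat_cong) (auto dest!: in_listsD cells_disjoint[of _ "cube n" p _ "Suc p"])
  moreover have "incidence a e = 0" if "a \<in> set (star_list n p)" "e \<in> set (one_list n (Suc p))" for a e
    using in_listsD(2)[OF that(1)] in_listsD(1)[OF that(2)] by (rule incidence_same_dim) simp
  ultimately show ?thesis
    unfolding dual_frame_def split_cells_def
    by (subst det_list_mat_block_lower)
      (use one_star_disjoint[of n "Suc p" p] in
        \<open>auto simp: det_incidence_one_star\<close>)
qed

lemma sum_delta_plus:
  assumes "finite C" "x \<in> C"
  shows "(\<Sum>c\<in>C. ((if x = c then 1 else 0) + h c) * g c) = g x + (\<Sum>c\<in>C. h c * g c :: int)"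
  using assms by (simp add: algebra_simps sum.distrib if_distrib[of "\<lambda>c. c * _"]
      if_distrib[of "\<lambda>c. _ * c"] cong: if_cong)

lemma dual_frame_row:
  assumes x: "x \<in> set (one_list n (Suc p))"
  shows "(\<Sum>c\<in>cells (cube n) (Suc p). ((if x = c then 1 else 0) + incidence c x) * g c) = g x"
proof -
  have "(\<Sum>c\<in>cells (cube n) (Suc p). incidence c x * g c) = 0"
    using in_listsD(1)[OF x] by (intro sum.neutral) (auto simp: incidence_same_dim)
  then show ?thesis using in_listsD(1)[OF x] by (simp add: sum_delta_plus)
qed

lemma dual_frame_row':
  assumes x: "x \<in> set (one_list n p)"
  shows "(\<Sum>c\<in>cells (cube n) (Suc p). ((if x = c then 1 else 0) + incidence c x) * g c)
    = (\<Sum>c\<in>cells (cube n) (Suc p). incidence c x * g c)"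
  using in_listsD(1)[OF x] by (intro sum.cong) (auto simp: cells_def)

text \<open>
  Multiplying by the unimodular dual frame makes the matrix block triangular: \<open>D\<close> kills the cycles, and
  the diagonal blocks are the matching block and \<open>D D\<^sup>T\<close>.
\<close>

lemma det_cycle_frame: "det (cycle_frame n p) = tree_det n p"
proof -
  let ?C = "cells (cube n) (Suc p)"
  let ?X = "one_list n (Suc p) @ one_list n p" and ?Y = "star_list n (Suc p) @ one_list n p"
  let ?f = "\<lambda>x y. \<Sum>c\<in>?C. ((if x = c then 1 else 0) + incidence c x) * dirac c y"
  have carr: "dual_frame n p \<in> carrier_mat (length ?Y) (length ?Y)"
    "cycle_frame n p \<in> carrier_mat (length ?Y) (length ?Y)"
    by (auto simp: dual_frame_def cycle_frame_def split_cells_def)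
  have prod: "dual_frame n p * cycle_frame n p = list_mat ?X ?Y ?f"
    by (simp add: dual_frame_def cycle_frame_def list_mat_mult[OF distinct_split_cells])
  have "det (cycle_frame n p) = det (list_mat ?X ?Y ?f)"
    unfolding prod[symmetric] by (simp add: det_mult[OF carr] det_dual_frame)
  also have "\<dots> = det (list_mat (one_list n (Suc p)) (star_list n (Suc p)) ?f)
      * det (list_mat (one_list n p) (one_list n p) ?f)"
  proof (rule det_list_mat_block_upper)
    fix x y assume x: "x \<in> set (one_list n p)" and y: "y \<in> set (star_list n (Suc p))"
    have "?f x y = (\<Sum>c\<in>?C. incidence y c * incidence c x)"
      unfolding dual_frame_row'[OF x]
      using in_listsD(2)[OF y] by (intro sum.cong) (auto simp: dirac_upper)
    then show "?f x y = 0" using sum_incidence_incidence[OF in_listsD(2)[OF y]] by simp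
  qed auto
  finally have split: "det (cycle_frame n p)
      = det (list_mat (one_list n (Suc p)) (star_list n (Suc p)) ?f)
      * det (list_mat (one_list n p) (one_list n p) ?f)" .
  have top: "list_mat (one_list n (Suc p)) (star_list n (Suc p)) ?f
      = list_mat (one_list n (Suc p)) (star_list n (Suc p)) (\<lambda>e a. incidence a e)"
    by (rule list_mat_cong) (simp add: dual_frame_row dirac_upper[OF in_listsD(1) in_listsD(2)])
  have bot: "list_mat (one_list n p) (one_list n p) ?f = list_mat (one_list n p) (one_list n p)
      (\<lambda>e e'. \<Sum>c\<in>?C. incidence c e * incidence c e')"
    by (rule list_mat_cong) (simp add: dual_frame_row' dirac_lower[OF _ in_listsD(1)])
  show ?thesis
    using split unfolding top bot by (simp add: det_incidence_one_star tree_det_def)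
qed

text \<open>
  A primitive lattice and its orthogonal complement have the same covolume. Here the Gram matrix of the
  frame is block diagonal, so its determinant \<open>(tree_det)\<^sup>2\<close> is the product of \<open>cycle_gram\<close> and
  \<open>tree_det\<close>.
\<close>

lemma cycle_gram_eq_tree_det: "cycle_gram n (Suc p) = tree_det n p"
proof -
  let ?C = "cells (cube n) (Suc p)"
  let ?A = "star_list n (Suc p)" and ?E = "one_list n p"
  let ?f = "\<lambda>x y. \<Sum>c\<in>?C. dirac c x * dirac c y"
  have carr: "cycle_frame n p \<in> carrier_mat (length (?A @ ?E)) (length (?A @ ?E))"
    by (auto simp: cycle_frame_def split_cells_def)
  have prod: "transpose_mat (cycle_frame n p) * cycle_frame n p = list_mat (?A @ ?E) (?A @ ?E) ?f"
    by (simp add: cycle_frame_def list_mat_mult[OF distinct_split_cells])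
  have "(tree_det n p)\<^sup>2 = det (list_mat (?A @ ?E) (?A @ ?E) ?f)"
    unfolding prod[symmetric] using carr by (subst det_mult[OF _ carr])
      (auto simp: det_transpose[OF carr] det_cycle_frame power2_eq_square)
  also have "\<dots> = det (list_mat ?A ?A ?f) * det (list_mat ?E ?E ?f)"
  proof (rule det_list_mat_block_upper)
    fix x y assume x: "x \<in> set ?E" and y: "y \<in> set ?A"
    have "?f x y = (\<Sum>c\<in>?C. incidence y c * incidence c x)"
      using in_listsD(2)[OF y] in_listsD(1)[OF x]
      by (intro sum.cong) (auto simp: dirac_upper dirac_lower)
    then show "?f x y = 0" using sum_incidence_incidence[OF in_listsD(2)[OF y]] by simp
  qed auto
  finally have split: "(tree_det n p)\<^sup>2 = det (list_mat ?A ?A ?f) * det (list_mat ?E ?E ?f)" .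
  have top: "list_mat ?A ?A ?f = list_mat ?A ?A (\<lambda>a a'. \<Sum>c\<in>?C. incidence a c * incidence a' c)"
    by (rule list_mat_cong) (simp add: dirac_upper[OF _ in_listsD(2)])
  have bot: "list_mat ?E ?E ?f = list_mat ?E ?E (\<lambda>e e'. \<Sum>c\<in>?C. incidence c e * incidence c e')"
    by (rule list_mat_cong) (simp add: dirac_lower[OF _ in_listsD(1)])
  have "(tree_det n p)\<^sup>2 = cycle_gram n (Suc p) * tree_det n p"
    using split unfolding top bot by (simp add: tree_det_def cycle_gram_def)
  then show ?thesis using tree_det_pos[of n p] by (simp add: power2_eq_square)
qed

lemma sum_mult_swap:
  fixes f :: "'b \<Rightarrow> 'c :: comm_semiring_0"
  shows "(\<Sum>c\<in>C. (\<Sum>h\<in>D. f h * g c h) * k c) = (\<Sum>h\<in>D. f h * (\<Sum>c\<in>C. g c h * k c))"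
    and "(\<Sum>c\<in>C. (\<Sum>h\<in>D. f h * g c h) * k c) = (\<Sum>h\<in>D. f h * (\<Sum>c\<in>C. k c * g c h))"
proof -
  show "(\<Sum>c\<in>C. (\<Sum>h\<in>D. f h * g c h) * k c) = (\<Sum>h\<in>D. f h * (\<Sum>c\<in>C. g c h * k c))"
    unfolding sum_distrib_right sum_distrib_left mult.assoc by (rule sum.swap)
  then show "(\<Sum>c\<in>C. (\<Sum>h\<in>D. f h * g c h) * k c) = (\<Sum>h\<in>D. f h * (\<Sum>c\<in>C. k c * g c h))"
    by (simp only: mult.commute[of "k _"])
qed

text \<open>
  Since a boundary is a cycle, it is known from its \<open>one_list\<close> coordinates: the boundary map is \<open>D\<close>,
  followed by the inverse of the matching block, followed by the expansion in the basis of cycles. The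
  matrices below are the transposes, whose rows are indexed by the cells of higher dimension.
\<close>

lemma boundary_factorization:
  obtains v where
    "det (list_mat (one_list n (Suc p)) (star_list n (Suc p)) v) = 1"
    "list_mat (split_cells n (Suc p)) (split_cells n p) incidence =
      list_mat (split_cells n (Suc p)) (one_list n (Suc p)) incidence *
      list_mat (one_list n (Suc p)) (star_list n (Suc p)) v *
      list_mat (star_list n (Suc p)) (split_cells n p) incidence"
proof -
  let ?E = "one_list n (Suc p)" and ?A = "star_list n (Suc p)"
  obtain v where v: "det (list_mat ?E ?A v) = 1"
    and right: "\<And>e e'. e \<in> set ?E \<Longrightarrow> e' \<in> set ?E \<Longrightarrow>
      (\<Sum>a\<in>set ?A. incidence a e * v e' a) = (if e = e' then 1 else 0)"
    and "\<And>a a'. a \<in> set ?A \<Longrightarrow> a' \<in> set ?A \<Longrightarrow>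
      (\<Sum>e\<in>set ?E. v e a * incidence a' e) = (if a = a' then 1 else 0)"
    by (rule one_star_inverse[of n "Suc p"]) (rule that)
  define w where "w c a = (\<Sum>e\<in>set ?E. incidence c e * v e a)" for c a
  have eq: "incidence c g = (\<Sum>a\<in>set ?A. w c a * incidence a g)"
    if c: "c \<in> cells (cube n) (Suc (Suc p))" and g: "g \<in> cells (cube n) (Suc p)" for c g
  proof -
    let ?z = "\<lambda>g. incidence c g - (\<Sum>a\<in>set ?A. w c a * incidence a g)"
    have "?z g = 0"
    proof (rule cycle_eq_0[OF _ _ g])
      fix e assume e: "e \<in> set ?E"
      have "(\<Sum>a\<in>set ?A. w c a * incidence a e)
          = (\<Sum>e'\<in>set ?E. incidence c e' * (\<Sum>a\<in>set ?A. incidence a e * v e' a))"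
        unfolding w_def by (rule sum_mult_swap)
      also have "\<dots> = (\<Sum>e'\<in>set ?E. if e = e' then incidence c e' else 0)"
        by (rule sum.cong) (auto simp: right[OF e])
      finally show "?z e = 0" using e by simp
    next
      fix H
      have "(\<Sum>G\<in>cells (cube n) (Suc p). (\<Sum>a\<in>set ?A. w c a * incidence a G) * incidence G H)
          = (\<Sum>a\<in>set ?A. w c a * (\<Sum>G\<in>cells (cube n) (Suc p). incidence a G * incidence G H))"
        by (rule sum_mult_swap)
      also have "\<dots> = 0"
        by (rule sum.neutral) (simp add: sum_incidence_incidence in_listsD)
      finally show "(\<Sum>G\<in>cells (cube n) (Suc p). ?z G * incidence G H) = 0"
        by (simp add: left_diff_distrib sum_subtractf sum_incidence_incidence[OF c])
    qed
    then show ?thesis by simp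
  qed
  show ?thesis
  proof (rule that[OF v])
    show "list_mat (split_cells n (Suc p)) (split_cells n p) incidence =
      list_mat (split_cells n (Suc p)) ?E incidence * list_mat ?E ?A v *
      list_mat ?A (split_cells n p) incidence"
      unfolding list_mat_mult[OF distinct_one_list] list_mat_mult[OF distinct_star_list]
      by (rule list_mat_cong) (simp add: eq flip: w_def)
  qed
qed

text \<open>
  The diagonal blocks that the Laplacian acquires between the dual frame and the frame: \<open>D\<partial>\<^sup>TM\<close>, with the
  basis of cycles in the columns of \<open>M\<close>, and \<open>D\<partial>\<^sup>T\<partial>D\<^sup>T\<close>. By the factorization of \<open>\<partial>\<close> both are products
  of square matrices \<open>DD\<^sup>T\<close>, \<open>M\<^sup>TM\<close> and unimodular ones.
\<close>

lemma det_frame_block: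
  "det (list_mat (one_list n (Suc p)) (star_list n (Suc p))
     (\<lambda>e a. \<Sum>c\<in>cells (cube n) (Suc p).
        (\<Sum>H\<in>cells (cube n) (Suc (Suc p)). incidence H e * incidence H c) * incidence a c))
   = tree_det n (Suc p) * tree_det n p"
  "det (list_mat (one_list n (Suc p)) (one_list n (Suc p))
     (\<lambda>e e'. \<Sum>c\<in>cells (cube n) (Suc p).
        (\<Sum>H\<in>cells (cube n) (Suc (Suc p)). incidence H e * incidence H c) *
        (\<Sum>H\<in>cells (cube n) (Suc (Suc p)). incidence H c * incidence H e')))
   = (tree_det n (Suc p))\<^sup>2 * tree_det n p"
proof -
  let ?E = "one_list n (Suc p)" and ?A = "star_list n (Suc p)"
  let ?C = "split_cells n p" and ?C' = "split_cells n (Suc p)"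
  define r m m' where "r = length ?E" and "m = length ?C" and "m' = length ?C'"
  obtain v where v: "det (list_mat ?E ?A v) = 1"
    and K: "list_mat ?C' ?C incidence =
      list_mat ?C' ?E incidence * list_mat ?E ?A v * list_mat ?A ?C incidence"
    by (rule boundary_factorization[of n p]) (rule that)
  define N V P where "N = list_mat ?C' ?E incidence" and "V = list_mat ?E ?A v"
    and "P = list_mat ?A ?C incidence"
  have carr [simp]: "N \<in> carrier_mat m' r" "V \<in> carrier_mat r r" "P \<in> carrier_mat r m"
    "transpose_mat N \<in> carrier_mat r m'" "transpose_mat V \<in> carrier_mat r r"
    "transpose_mat P \<in> carrier_mat m r"
    by (auto simp: N_def V_def P_def r_def m_def m'_def intro!: carrier_matI)
  have dV: "det V = 1" "det (transpose_mat V) = 1"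
    using v det_transpose[OF carr(2)] by (simp_all add: V_def)
  have NN: "det (transpose_mat N * N) = tree_det n (Suc p)"
    by (simp add: N_def list_mat_mult[OF distinct_split_cells] tree_det_def)
  have PP: "det (P * transpose_mat P) = tree_det n p"
    by (simp add: P_def list_mat_mult[OF distinct_split_cells] cycle_gram_def
        flip: cycle_gram_eq_tree_det)
  have NNc: "transpose_mat N * N \<in> carrier_mat r r" and PPc: "P * transpose_mat P \<in> carrier_mat r r"
    using mult_carrier_mat[OF carr(4) carr(1)] mult_carrier_mat[OF carr(3) carr(6)] by simp_all
  have VNN: "transpose_mat V * (transpose_mat N * N) \<in> carrier_mat r r"
    by (rule mult_carrier_mat[OF carr(5) NNc])
  have NV: "N * V \<in> carrier_mat m' r" and NVP: "N * V * P \<in> carrier_mat m' m"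
    by (rule mult_carrier_mat[of _ _ r], (rule carr mult_carrier_mat[of _ _ r])+)+
  have "list_mat ?E ?A (\<lambda>e a. \<Sum>c\<in>cells (cube n) (Suc p).
        (\<Sum>H\<in>cells (cube n) (Suc (Suc p)). incidence H e * incidence H c) * incidence a c)
      = transpose_mat N * list_mat ?C' ?C incidence * transpose_mat P"
    by (simp add: N_def P_def list_mat_mult[OF distinct_split_cells])
  also have "\<dots> = (transpose_mat N * N) * V * (P * transpose_mat P)"
    unfolding K N_def[symmetric] V_def[symmetric] P_def[symmetric]
    by (simp add: assoc_mult_mat[OF carr(4) NVP carr(6)] assoc_mult_mat[OF NV carr(3,6)]
        assoc_mult_mat[OF carr(4) NV PPc] assoc_mult_mat[OF carr(4,1,2)])
  finally have first: "list_mat ?E ?A (\<lambda>e a. \<Sum>c\<in>cells (cube n) (Suc p).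
        (\<Sum>H\<in>cells (cube n) (Suc (Suc p)). incidence H e * incidence H c) * incidence a c)
      = (transpose_mat N * N) * V * (P * transpose_mat P)" .
  show "det (list_mat ?E ?A (\<lambda>e a. \<Sum>c\<in>cells (cube n) (Suc p).
        (\<Sum>H\<in>cells (cube n) (Suc (Suc p)). incidence H e * incidence H c) * incidence a c))
   = tree_det n (Suc p) * tree_det n p"
    unfolding first
    using NNc PPc by (simp add: det_mult[of _ r] NN PP dV mult_carrier_mat[of _ _ r])
  have "list_mat ?E ?E (\<lambda>e e'. \<Sum>c\<in>cells (cube n) (Suc p).
        (\<Sum>H\<in>cells (cube n) (Suc (Suc p)). incidence H e * incidence H c) *
        (\<Sum>H\<in>cells (cube n) (Suc (Suc p)). incidence H c * incidence H e'))
      = (transpose_mat N * list_mat ?C' ?C incidence) *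
        (transpose_mat (list_mat ?C' ?C incidence) * N)"
    by (simp add: N_def list_mat_mult[OF distinct_split_cells])
  also have "transpose_mat N * list_mat ?C' ?C incidence = (transpose_mat N * N) * V * P"
    unfolding K N_def[symmetric] V_def[symmetric] P_def[symmetric]
    by (simp only: assoc_mult_mat[OF carr(4) NV carr(3)] assoc_mult_mat[OF carr(4,1,2)]
        assoc_mult_mat[OF NNc carr(2,3)])
  also have "transpose_mat (list_mat ?C' ?C incidence) * N = transpose_mat P * (transpose_mat V * (transpose_mat N * N))"
    unfolding K N_def[symmetric] V_def[symmetric] P_def[symmetric]
    by (simp only: transpose_mult[OF NV carr(3)] transpose_mult[OF carr(1,2)]
       assoc_mult_mat[OF carr(6) mult_carrier_mat[OF carr(5,4)] carr(1)]
       assoc_mult_mat[OF carr(5,4,1)])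
  also have "(transpose_mat N * N) * V * P * (transpose_mat P * (transpose_mat V * (transpose_mat N * N)))
      = (transpose_mat N * N) * V * ((P * transpose_mat P) * (transpose_mat V * (transpose_mat N * N)))"
    by (simp only: assoc_mult_mat[OF mult_carrier_mat[OF NNc carr(2)] carr(3) mult_carrier_mat[OF carr(6) VNN]]
        assoc_mult_mat[OF carr(3,6) VNN])
  finally have second: "list_mat ?E ?E (\<lambda>e e'. \<Sum>c\<in>cells (cube n) (Suc p).
        (\<Sum>H\<in>cells (cube n) (Suc (Suc p)). incidence H e * incidence H c) *
        (\<Sum>H\<in>cells (cube n) (Suc (Suc p)). incidence H c * incidence H e'))
      = (transpose_mat N * N) * V * ((P * transpose_mat P) * (transpose_mat V * (transpose_mat N * N)))" .
  show "det (list_mat ?E ?E (\<lambda>e e'. \<Sum>c\<in>cells (cube n) (Suc p).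
        (\<Sum>H\<in>cells (cube n) (Suc (Suc p)). incidence H e * incidence H c) *
        (\<Sum>H\<in>cells (cube n) (Suc (Suc p)). incidence H c * incidence H e')))
   = (tree_det n (Suc p))\<^sup>2 * tree_det n p"
    unfolding second
    using NNc PPc by (simp add: det_mult[of _ r] NN PP dV mult_carrier_mat[of _ _ r] power2_eq_square)
qed

text \<open>
  The Laplacian maps cycles to cycles and acts on them as \<open>\<partial>\<partial>\<^sup>T\<close>, and on their orthogonal complement as
  \<open>\<partial>\<^sup>T\<partial>\<close>. So it is block triangular between the two frames, whose determinants are \<open>1\<close> and \<open>tree_det\<close>.
\<close>

theorem det_laplacian_tree_det:
  "det (list_mat (split_cells n (Suc p)) (split_cells n (Suc p)) (laplacian n))
    = tree_det n (Suc (Suc p)) * (tree_det n (Suc p))\<^sup>2 * tree_det n p"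
proof -
  define q where "q = Suc p"
  let ?C = "cells (cube n) (Suc q)" and ?up = "cells (cube n) (Suc (Suc q))"
  let ?down = "cells (cube n) q"
  let ?S = "split_cells n q"
  let ?X = "one_list n (Suc q) @ one_list n q" and ?Y = "star_list n (Suc q) @ one_list n q"
  let ?L = "list_mat ?S ?S (laplacian n)"
  let ?g = "\<lambda>c y. \<Sum>c'\<in>?C. laplacian n c c' * dirac c' y"
  let ?f = "\<lambda>x y. \<Sum>c\<in>?C. ((if x = c then 1 else 0) + incidence c x) * ?g c y"
  have carr: "dual_frame n q \<in> carrier_mat (length ?S) (length ?S)"
    "cycle_frame n q \<in> carrier_mat (length ?S) (length ?S)" "?L \<in> carrier_mat (length ?S) (length ?S)"
    by (auto simp: dual_frame_def cycle_frame_def split_cells_def intro!: carrier_matI)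
  have prod: "dual_frame n q * (?L * cycle_frame n q) = list_mat ?X ?Y ?f"
    by (simp add: dual_frame_def cycle_frame_def list_mat_mult[OF distinct_split_cells])
  have up: "?g c a = (\<Sum>c'\<in>?C. (\<Sum>H\<in>?up. incidence H c * incidence H c') * incidence a c')"
    if c: "c \<in> ?C" and a: "a \<in> set (star_list n (Suc q))" for c a
  proof -
    have "?g c a = (\<Sum>c'\<in>?C. (\<Sum>H\<in>?up. incidence H c * incidence H c') * incidence a c')
        + (\<Sum>c'\<in>?C. (\<Sum>G\<in>?down. incidence c G * incidence c' G) * incidence a c')"
      by (simp add: laplacian_on_cells[OF c] dirac_upper[OF _ in_listsD(2)[OF a]]
          distrib_right sum.distrib)
    also have "(\<Sum>c'\<in>?C. (\<Sum>G\<in>?down. incidence c G * incidence c' G) * incidence a c')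
        = (\<Sum>G\<in>?down. incidence c G * (\<Sum>c'\<in>?C. incidence a c' * incidence c' G))"
      by (rule sum_mult_swap)
    also have "\<dots> = 0"
      using sum_incidence_incidence[OF in_listsD(2)[OF a]] by simp
    finally show ?thesis by simp
  qed
  have down: "?g c e = (\<Sum>G\<in>?down. incidence c G * (\<Sum>c'\<in>?C. incidence c' G * incidence c' e))"
    if c: "c \<in> ?C" and e: "e \<in> set (one_list n q)" for c e
  proof -
    have "?g c e = (\<Sum>c'\<in>?C. (\<Sum>H\<in>?up. incidence H c * incidence H c') * incidence c' e)
        + (\<Sum>c'\<in>?C. (\<Sum>G\<in>?down. incidence c G * incidence c' G) * incidence c' e)"
      by (simp add: laplacian_on_cells[OF c] dirac_lower[OF _ in_listsD(1)[OF e]]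
          distrib_right sum.distrib)
    also have "(\<Sum>c'\<in>?C. (\<Sum>H\<in>?up. incidence H c * incidence H c') * incidence c' e)
        = (\<Sum>H\<in>?up. incidence H c * (\<Sum>c'\<in>?C. incidence H c' * incidence c' e))"
      by (rule sum_mult_swap)
    also have "\<dots> = 0"
      by (rule sum.neutral) (simp add: sum_incidence_incidence)
    also have "(\<Sum>c'\<in>?C. (\<Sum>G\<in>?down. incidence c G * incidence c' G) * incidence c' e)
        = (\<Sum>G\<in>?down. incidence c G * (\<Sum>c'\<in>?C. incidence c' G * incidence c' e))"
      by (rule sum_mult_swap)
    finally show ?thesis by simp
  qed
  have "det ?L * tree_det n q = det (list_mat ?X ?Y ?f)"
    unfolding prod[symmetric]
    using carr by (simp add: det_mult[of _ "length ?S"] mult_carrier_mat[of _ _ "length ?S"]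
        det_dual_frame det_cycle_frame)
  also have "\<dots> = det (list_mat (one_list n (Suc q)) (star_list n (Suc q)) ?f)
      * det (list_mat (one_list n q) (one_list n q) ?f)"
  proof (rule det_list_mat_block_upper)
    fix e a assume e: "e \<in> set (one_list n q)" and a: "a \<in> set (star_list n (Suc q))"
    have "?f e a = (\<Sum>c\<in>?C. incidence c e *
        (\<Sum>c'\<in>?C. (\<Sum>H\<in>?up. incidence H c * incidence H c') * incidence a c'))"
      unfolding dual_frame_row'[OF e] by (intro sum.cong) (simp_all add: up[OF _ a])
    also have "\<dots> = (\<Sum>c\<in>?C. (\<Sum>H\<in>?up. (\<Sum>c'\<in>?C. incidence a c' * incidence H c') * incidence H c)
        * incidence c e)"
    proof (rule sum.cong[OF refl])
      fix c
      have "(\<Sum>c'\<in>?C. (\<Sum>H\<in>?up. incidence H c * incidence H c') * incidence a c')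
          = (\<Sum>H\<in>?up. incidence H c * (\<Sum>c'\<in>?C. incidence a c' * incidence H c'))"
        by (rule sum_mult_swap)
      then show "incidence c e * (\<Sum>c'\<in>?C. (\<Sum>H\<in>?up. incidence H c * incidence H c') * incidence a c')
          = (\<Sum>H\<in>?up. (\<Sum>c'\<in>?C. incidence a c' * incidence H c') * incidence H c) * incidence c e"
        by (simp only: mult.commute)
    qed
    also have "\<dots> = (\<Sum>H\<in>?up. (\<Sum>c'\<in>?C. incidence a c' * incidence H c') *
        (\<Sum>c\<in>?C. incidence H c * incidence c e))"
      by (rule sum_mult_swap)
    also have "\<dots> = 0"
      by (rule sum.neutral) (simp add: sum_incidence_incidence)
    finally show "?f e a = 0" .
  qed simp_all
  finally have split: "det ?L * tree_det n q
      = det (list_mat (one_list n (Suc q)) (star_list n (Suc q)) ?f)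
      * det (list_mat (one_list n q) (one_list n q) ?f)" .
  have top: "list_mat (one_list n (Suc q)) (star_list n (Suc q)) ?f
      = list_mat (one_list n (Suc q)) (star_list n (Suc q))
       (\<lambda>e a. \<Sum>c\<in>?C. (\<Sum>H\<in>?up. incidence H e * incidence H c) * incidence a c)"
    by (rule list_mat_cong) (simp add: dual_frame_row up[OF in_listsD(1)])
  have bot: "list_mat (one_list n q) (one_list n q) ?f = list_mat (one_list n q) (one_list n q)
     (\<lambda>e e'. \<Sum>G\<in>?down. (\<Sum>c\<in>?C. incidence c e * incidence c G) *
        (\<Sum>c\<in>?C. incidence c G * incidence c e'))"
  proof (rule list_mat_cong)
    fix e e' assume e: "e \<in> set (one_list n q)" "e' \<in> set (one_list n q)"
    have "?f e e' = (\<Sum>c\<in>?C. \<Sum>G\<in>?down. incidence c e * incidence c G *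
        (\<Sum>c'\<in>?C. incidence c' G * incidence c' e'))"
      unfolding dual_frame_row'[OF e(1)]
      by (intro sum.cong refl) (simp add: down[OF _ e(2)] sum_distrib_left mult.assoc)
    also have "\<dots> = (\<Sum>G\<in>?down. \<Sum>c\<in>?C. incidence c e * incidence c G *
        (\<Sum>c'\<in>?C. incidence c' G * incidence c' e'))"
      by (rule sum.swap)
    finally show "?f e e' = (\<Sum>G\<in>?down. (\<Sum>c\<in>?C. incidence c e * incidence c G) *
        (\<Sum>c\<in>?C. incidence c G * incidence c e'))"
      by (simp only: sum_distrib_right)
  qed
  have "det ?L * tree_det n q = tree_det n (Suc q) * tree_det n q * ((tree_det n q)\<^sup>2 * tree_det n p)"
    using split unfolding top bot det_frame_block(1) unfolding q_def det_frame_block(2) .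
  then show ?thesis
    using tree_det_pos[of n q] by (simp add: q_def mult_ac)
qed

text \<open>
  The spectrum turns the previous identity into a recursion that determines \<open>tree_det n p\<close> from the next
  two values, starting beyond the top dimension, where the matrix is empty. The exponents match because
  \<open>binom(j, p + 2) = binom(j - 2, p + 2) + 2 binom(j - 2, p + 1) + binom(j - 2, p)\<close>.
\<close>

theorem tree_det_formula:
  "tree_det n p = (\<Prod>j = p + 2..n. (2 * int j) ^ ((n choose j) * ((j - 2) choose p)))"
proof (induction "n - p" arbitrary: p rule: less_induct)
  case less
  show ?case
  proof (cases "p < n")
    case False
    then show ?thesis by (simp add: tree_det_def one_list_eq_Nil)
  next
    case True
    let ?F = "\<lambda>q. \<Prod>j = p + 2..n. (2 * int j) ^ ((n choose j) * ((j - 2) choose q))"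
    have tree: "tree_det n q = ?F q" if q: "p < q" for q
    proof -
      have "tree_det n q = (\<Prod>j = q + 2..n. (2 * int j) ^ ((n choose j) * ((j - 2) choose q)))"
        using True q by (intro less) simp
      also have "\<dots> = ?F q"
        using q by (intro prod.mono_neutral_left) (auto simp: binomial_eq_0)
      finally show ?thesis .
    qed
    have "det (list_mat (split_cells n (Suc p)) (split_cells n (Suc p)) (laplacian n))
        = det (list_mat (cell_list n (p + 2)) (cell_list n (p + 2)) (laplacian n))"
      by (rule det_list_mat_reorder)
        (simp_all add: distinct_split_cells distinct_cell_list set_cell_list)
    also have "\<dots> = (\<Prod>j\<le>n. (2 * int j) ^ ((n choose j) * (j choose (p + 2))))"
      using det_laplacian[of n "p + 2" 0] by simp
    also have "\<dots> = (\<Prod>j = p + 2..n. (2 * int j) ^ ((n choose j) * (j choose (p + 2))))"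
      by (intro prod.mono_neutral_right) (auto simp: binomial_eq_0)
    also have "\<dots> = ?F (Suc (Suc p)) * (?F (Suc p))\<^sup>2 * ?F p"
    proof -
      have "j choose (p + 2) = ((j - 2) choose Suc (Suc p)) + ((j - 2) choose Suc p) + ((j - 2) choose Suc p) + ((j - 2) choose p)"
        if "p + 2 \<le> j" for j
      proof -
        define i where "i = j - 2"
        have "j = Suc (Suc i)" using that by (simp add: i_def)
        then show ?thesis by simp
      qed
      then show ?thesis
        unfolding power2_eq_square prod.distrib[symmetric] power_add[symmetric]
        by (intro prod.cong) (auto simp: algebra_simps)
    qed
    finally have "?F (Suc (Suc p)) * (?F (Suc p))\<^sup>2 * tree_det n p = ?F (Suc (Suc p)) * (?F (Suc p))\<^sup>2 * ?F p"
      unfolding det_laplacian_tree_det by (simp add: tree)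
    moreover have pos: "0 < ?F q" for q by (intro prod_pos) auto
    have "?F (Suc (Suc p)) * (?F (Suc p))\<^sup>2 \<noteq> 0"
      by (rule less_imp_neq[THEN not_sym], intro mult_pos_pos zero_less_power pos)
    ultimately show ?thesis by (rule mult_left_cancel[THEN iffD1, rotated])
  qed
qed

section \<open>Homology in coordinates\<close>

lemma chain_ex:
  assumes "finite S"
  shows "\<exists>c :: face \<Rightarrow>\<^sub>0 int. Poly_Mapping.keys c \<subseteq> S \<and> (\<forall>G\<in>S. Poly_Mapping.lookup c G = f G)"
proof -
  define c where "c = (\<Sum>G\<in>S. frag_cmul (f G) (frag_of G))"
  have lookup: "Poly_Mapping.lookup c H = (if H \<in> S then f H else 0)" for H
  proof -
    have "Poly_Mapping.lookup c H = (\<Sum>G\<in>S. if H = G then f G else 0)"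
      unfolding c_def lookup_sum by (rule sum.cong) (auto simp: lookup_single when_def)
    then show ?thesis using assms by simp
  qed
  then show ?thesis by (intro exI[of _ c]) (auto simp: in_keys_iff split: if_splits)
qed

lemma nth_extension:
  assumes "distinct xs"
  shows "\<exists>g. \<forall>i<length xs. g (xs ! i) = f i"
proof -
  have "the_inv_into {..<length xs} ((!) xs) (xs ! i) = i" if "i < length xs" for i
    using assms that by (intro the_inv_into_f_f) (auto simp: inj_on_nth)
  then show ?thesis
    by (intro exI[of _ "\<lambda>x. f (the_inv_into {..<length xs} ((!) xs) x)"]) simp
qed

lemma cells_0_cases:
  assumes "G \<in> cells (cube n) 0"
  shows "G \<in> set (one_list n 0) \<or> G = replicate n Zero"
  using assms unfolding set_cell_list[symmetric] by (induction n arbitrary: G) auto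

lemma augmentation_sum:
  assumes "finite S" "Poly_Mapping.keys c \<subseteq> S"
  shows "augmentation c = (\<Sum>G\<in>S. Poly_Mapping.lookup c G)"
  unfolding augmentation_def using assms
  by (intro sum.mono_neutral_left) (auto simp: in_keys_iff)

text \<open>
  In dimension \<open>0\<close> a chain with vanishing \<open>one_list\<close> coordinates is a multiple of the vertex \<open>(0, \<dots>, 0)\<close>, which
  the augmentation detects.
\<close>

lemma reduced_cycle_eq_0:
  assumes z: "z \<in> reduced_cycles (cube n) p"
    and zero: "\<And>e. e \<in> set (one_list n p) \<Longrightarrow> Poly_Mapping.lookup z e = 0"
  shows "z = 0"
proof -
  have keys: "Poly_Mapping.keys z \<subseteq> cells (cube n) p"
    using z by (simp add: reduced_cycles_def chain_group_def)
  have "Poly_Mapping.lookup z G = 0" if G: "G \<in> cells (cube n) p" for G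
  proof (cases p)
    case 0
    have "augmentation z = (\<Sum>G\<in>cells (cube n) 0. Poly_Mapping.lookup z G)"
      using keys 0 by (intro augmentation_sum) auto
    also have "\<dots> = (\<Sum>G\<in>cells (cube n) 0. if G = replicate n Zero then Poly_Mapping.lookup z G else 0)"
      using zero 0 by (intro sum.cong) (auto dest: cells_0_cases)
    also have "\<dots> = Poly_Mapping.lookup z (replicate n Zero)"
    proof -
      have "replicate n Zero \<in> cells (cube n) 0" by (simp add: cells_def cube_def face_dim_def)
      then show ?thesis by simp
    qed
    finally have "Poly_Mapping.lookup z (replicate n Zero) = 0"
      using z 0 by (simp add: reduced_cycles_def)
    then show ?thesis using G zero 0 cells_0_cases[of G n] by auto
  next
    case (Suc q)
    have "bd z = 0" using z Suc by (simp add: reduced_cycles_def)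
    then have sums: "(\<Sum>G\<in>cells (cube n) (Suc q). Poly_Mapping.lookup z G * incidence G H) = 0" for H
      using lookup_bd[of "cells (cube n) (Suc q)" z H] keys Suc by simp
    show ?thesis
      using zero sums G unfolding Suc by (rule cycle_eq_0[of n q "Poly_Mapping.lookup z" G])
  qed
  then show ?thesis using keys by (auto intro!: poly_mapping_eqI simp: in_keys_iff)
qed

lemma subcomplex_cube: "subcomplex (cube n) (cube n)"
  by (simp add: subcomplex_def)

text \<open>
  Together with the previous uniqueness, this identifies reduced cycles with vectors of \<open>one_list\<close>
  coordinates.
\<close>

lemma reduced_cycle_lift:
  "\<exists>c. Poly_Mapping.keys c \<subseteq> set (star_list n p) \<and>
     (\<forall>i<length (one_list n p). Poly_Mapping.lookup (bd c) (one_list n p ! i) = f i)"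
proof -
  obtain g where g: "\<And>i. i < length (one_list n p) \<Longrightarrow> g (one_list n p ! i) = f i"
    using nth_extension[OF distinct_one_list, of n p f] by blast
  obtain v where "det (list_mat (one_list n p) (star_list n p) v) = 1"
    and right: "\<And>e e'. e \<in> set (one_list n p) \<Longrightarrow> e' \<in> set (one_list n p) \<Longrightarrow>
      (\<Sum>a\<in>set (star_list n p). incidence a e * v e' a) = (if e = e' then 1 else 0)"
    and "\<And>a a'. a \<in> set (star_list n p) \<Longrightarrow> a' \<in> set (star_list n p) \<Longrightarrow>
      (\<Sum>e\<in>set (one_list n p). v e a * incidence a' e) = (if a = a' then 1 else 0)"
    by (rule one_star_inverse[of n p]) (rule that)
  obtain c where c: "Poly_Mapping.keys c \<subseteq> set (star_list n p)"
    "\<And>a. a \<in> set (star_list n p) \<Longrightarrow>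
      Poly_Mapping.lookup c a = (\<Sum>e'\<in>set (one_list n p). g e' * v e' a)"
    using chain_ex[of "set (star_list n p)" "\<lambda>a. \<Sum>e'\<in>set (one_list n p). g e' * v e' a"] by auto
  have "Poly_Mapping.lookup (bd c) e = g e" if e: "e \<in> set (one_list n p)" for e
  proof -
    have "Poly_Mapping.lookup (bd c) e = (\<Sum>a\<in>set (star_list n p). Poly_Mapping.lookup c a * incidence a e)"
      using c(1) by (intro lookup_bd) auto
    also have "\<dots> = (\<Sum>a\<in>set (star_list n p). (\<Sum>e'\<in>set (one_list n p). g e' * v e' a) * incidence a e)"
      by (rule sum.cong) (simp_all add: c(2))
    also have "\<dots> = (\<Sum>e'\<in>set (one_list n p). g e' * (\<Sum>a\<in>set (star_list n p). incidence a e * v e' a))"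
      by (rule sum_mult_swap)
    also have "\<dots> = (\<Sum>e'\<in>set (one_list n p). if e = e' then g e' else 0)"
      by (rule sum.cong) (auto simp: right[OF e])
    finally show ?thesis using e by simp
  qed
  then show ?thesis using c(1) g by (intro exI[of _ c]) simp
qed

lemma bd_star_in_cycles:
  assumes "Poly_Mapping.keys c \<subseteq> set (star_list n p)"
  shows "bd c \<in> reduced_cycles (cube n) p"
proof -
  have "bd c \<in> boundaries (cube n) p"
    using assms set_star_list_subset[of n p] by (auto simp: boundaries_def chain_group_def)
  then show ?thesis using boundaries_subset_reduced_cycles[OF subcomplex_cube] by blast
qed

lemma chain_group_mult [simp]: "a \<otimes>\<^bsub>chain_group Y p\<^esub> b = a + b"
  by (simp add: chain_group_def)

lemma reduced_cycle_diff:
  "a \<in> reduced_cycles Y p \<Longrightarrow> b \<in> reduced_cycles Y p \<Longrightarrow> a - b \<in> reduced_cycles Y p"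
  using keys_diff[of a b] unfolding reduced_cycles_def chain_group_def
  by (auto simp: bd_diff augmentation_eq frag_extend_diff lookup_minus split: if_splits)

text \<open>
  This contains the acyclicity of the cube.
\<close>

lemma cube_cycle_is_star_boundary:
  assumes z: "z \<in> reduced_cycles (cube n) p"
  obtains c where "Poly_Mapping.keys c \<subseteq> set (star_list n p)" "z = bd c"
proof -
  obtain c where c: "Poly_Mapping.keys c \<subseteq> set (star_list n p)"
    "\<And>i. i < length (one_list n p) \<Longrightarrow>
      Poly_Mapping.lookup (bd c) (one_list n p ! i) = Poly_Mapping.lookup z (one_list n p ! i)"
    using reduced_cycle_lift[of n p "\<lambda>i. Poly_Mapping.lookup z (one_list n p ! i)"] by blast
  have "z - bd c = 0"
  proof (rule reduced_cycle_eq_0)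
    show "z - bd c \<in> reduced_cycles (cube n) p"
      by (intro reduced_cycle_diff z bd_star_in_cycles c)
    fix e assume "e \<in> set (one_list n p)"
    then show "Poly_Mapping.lookup (z - bd c) e = 0"
      using c(2) by (auto simp: in_set_conv_nth lookup_minus)
  qed
  then show ?thesis using that c(1) by simp
qed

lemma boundaries_closed:
  "0 \<in> boundaries Y p"
  "a \<in> boundaries Y p \<Longrightarrow> b \<in> boundaries Y p \<Longrightarrow> a + b \<in> boundaries Y p"
  "a \<in> boundaries Y p \<Longrightarrow> b \<in> boundaries Y p \<Longrightarrow> a - b \<in> boundaries Y p"
proof -
  show "0 \<in> boundaries Y p"
    by (auto simp: boundaries_def chain_group_def image_iff intro!: bexI[of _ 0])
  assume "a \<in> boundaries Y p" "b \<in> boundaries Y p"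
  then obtain c d where "Poly_Mapping.keys c \<subseteq> cells Y (Suc p)" "Poly_Mapping.keys d \<subseteq> cells Y (Suc p)"
    "a = bd c" "b = bd d"
    by (auto simp: boundaries_def chain_group_def)
  then have "a + b = bd (c + d)" "a - b = bd (c - d)"
    "Poly_Mapping.keys (c + d) \<subseteq> cells Y (Suc p)" "Poly_Mapping.keys (c - d) \<subseteq> cells Y (Suc p)"
    using keys_add[of c d] keys_diff[of c d] by (auto simp only: bd_add bd_diff)
  then show "a + b \<in> boundaries Y p" "a - b \<in> boundaries Y p"
    by (auto simp: boundaries_def chain_group_def)
qed

definition homology_class :: "face set \<Rightarrow> nat \<Rightarrow> (face \<Rightarrow>\<^sub>0 int) \<Rightarrow> (face \<Rightarrow>\<^sub>0 int) set" where
  "homology_class Y p z = (\<lambda>b. b + z) ` boundaries Y p"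

lemma r_coset_homology_class:
  "r_coset (subgroup_generated (chain_group Y p) (reduced_cycles Y p)) (boundaries Y p) z
    = homology_class Y p z"
  by (auto simp: r_coset_def homology_class_def chain_group_def)

lemma carrier_reduced_homology:
  "carrier (reduced_homology Y p) = homology_class Y p ` reduced_cycles Y p"
  by (simp add: reduced_homology_def carrier_FactGroup carrier_reduced_cycles r_coset_homology_class)

lemma homology_class_eq_iff:
  "homology_class Y p z = homology_class Y p z' \<longleftrightarrow> z - z' \<in> boundaries Y p"
proof
  assume "homology_class Y p z = homology_class Y p z'"
  moreover have "z \<in> homology_class Y p z"
    using boundaries_closed(1)[of Y p] by (auto simp: homology_class_def image_iff intro!: bexI[of _ 0])
  ultimately show "z - z' \<in> boundaries Y p" by (auto simp: homology_class_def)
next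
  assume d: "z - z' \<in> boundaries Y p"
  show "homology_class Y p z = homology_class Y p z'"
    unfolding homology_class_def
  proof (intro equalityI image_subsetI)
    fix b assume b: "b \<in> boundaries Y p"
    show "b + z \<in> (\<lambda>b. b + z') ` boundaries Y p"
      using boundaries_closed(2)[OF b d] by (auto simp: image_iff intro!: bexI[of _ "b + (z - z')"])
    show "b + z' \<in> (\<lambda>b. b + z) ` boundaries Y p"
      using boundaries_closed(3)[OF b d] by (auto simp: image_iff intro!: bexI[of _ "b - (z - z')"])
  qed
qed

lemma normal_boundaries:
  assumes "subcomplex Y (cube n)"
  shows "normal (boundaries Y p) (subgroup_generated (chain_group Y p) (reduced_cycles Y p))"
    and "comm_group (subgroup_generated (chain_group Y p) (reduced_cycles Y p))"
proof -
  let ?G = "chain_group Y p"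
  have G: "group ?G" "comm_group ?G" by (simp_all add: chain_group_def abelian_free_Abelian_group)
  show comm: "comm_group (subgroup_generated ?G (reduced_cycles Y p))"
    using group.abelian_subgroup_generated[OF G] .
  have sub: "boundaries Y p \<subseteq> reduced_cycles Y p"
    by (rule boundaries_subset_reduced_cycles[OF assms])
  have "subgroup (boundaries Y p) (subgroup_generated ?G (reduced_cycles Y p))"
  proof (rule group.subgroupI)
    show "group (subgroup_generated ?G (reduced_cycles Y p))"
      by (rule group.group_subgroup_generated[OF G(1)])
    show "boundaries Y p \<subseteq> carrier (subgroup_generated ?G (reduced_cycles Y p))"
      using sub by (simp add: carrier_reduced_cycles)
    show "boundaries Y p \<noteq> {}" using boundaries_closed(1) by blast
    fix a assume a: "a \<in> boundaries Y p"
    have "inv\<^bsub>subgroup_generated ?G (reduced_cycles Y p)\<^esub> a = inv\<^bsub>?G\<^esub> a"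
      using a sub by (intro group.inv_subgroup_generated G) (auto simp: carrier_reduced_cycles)
    also have "\<dots> = - a"
      using a sub by (auto simp: chain_group_def reduced_cycles_def)
    finally show "inv\<^bsub>subgroup_generated ?G (reduced_cycles Y p)\<^esub> a \<in> boundaries Y p"
      using boundaries_closed(3)[OF boundaries_closed(1) a] by simp
    fix b assume "b \<in> boundaries Y p"
    then show "a \<otimes>\<^bsub>subgroup_generated ?G (reduced_cycles Y p)\<^esub> b \<in> boundaries Y p"
      using a boundaries_closed(2) by (simp add: chain_group_def)
  qed
  then show "normal (boundaries Y p) (subgroup_generated ?G (reduced_cycles Y p))"
    using comm_group.normal_iff_subgroup[OF comm] by blast
qed

lemma comm_group_reduced_homology:
  assumes "subcomplex Y (cube n)"
  shows "comm_group (reduced_homology Y p)"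
  unfolding reduced_homology_def
  using comm_group.abelian_FactGroup[OF normal_boundaries(2)[OF assms]]
    normal_boundaries(1)[OF assms] by (simp add: normal_imp_subgroup)

lemma one_reduced_homology: "\<one>\<^bsub>reduced_homology Y p\<^esub> = homology_class Y p 0"
  by (simp add: reduced_homology_def homology_class_def)

lemma homology_class_mult:
  assumes "subcomplex Y (cube n)" "x \<in> reduced_cycles Y p" "y \<in> reduced_cycles Y p"
  shows "homology_class Y p x \<otimes>\<^bsub>reduced_homology Y p\<^esub> homology_class Y p y = homology_class Y p (x + y)"
  using normal.rcos_sum[OF normal_boundaries(1)[OF assms(1)], of x p y] assms(2,3)
  by (simp add: r_coset_homology_class carrier_reduced_cycles reduced_homology_def)

lemma homology_class_int_pow:
  assumes Y: "subcomplex Y (cube n)" and x: "x \<in> reduced_cycles Y p"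
  shows "homology_class Y p x [^]\<^bsub>reduced_homology Y p\<^esub> (k :: int) = homology_class Y p (frag_cmul k x)"
    and "frag_cmul k x \<in> reduced_cycles Y p"
proof -
  let ?G = "subgroup_generated (chain_group Y p) (reduced_cycles Y p)"
  interpret N: normal "boundaries Y p" ?G by (rule normal_boundaries[OF Y])
  have pow: "x [^]\<^bsub>?G\<^esub> k = frag_cmul k x"
  proof -
    have "x [^]\<^bsub>?G\<^esub> k = x [^]\<^bsub>chain_group Y p\<^esub> k"
      using x by (intro group.int_pow_subgroup_generated)
        (simp_all add: carrier_reduced_cycles, simp add: chain_group_def)
    also have "\<dots> = frag_cmul k x"
      using x by (simp add: chain_group_def reduced_cycles_def)
    finally show ?thesis .
  qed
  have "x [^]\<^bsub>?G\<^esub> k \<in> carrier ?G"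
    using x by (intro N.int_pow_closed) (simp add: carrier_reduced_cycles)
  then show "frag_cmul k x \<in> reduced_cycles Y p"
    by (simp add: pow carrier_reduced_cycles)
  have "r_coset ?G (boundaries Y p) (x [^]\<^bsub>?G\<^esub> k)
      = r_coset ?G (boundaries Y p) x [^]\<^bsub>?G Mod boundaries Y p\<^esub> k"
    using x by (intro hom_int_pow[OF N.r_coset_hom_Mod _ N.is_group N.factorgroup_is_group])
      (simp add: carrier_reduced_cycles)
  then show "homology_class Y p x [^]\<^bsub>reduced_homology Y p\<^esub> k = homology_class Y p (frag_cmul k x)"
    by (simp add: pow r_coset_homology_class reduced_homology_def)
qed

lemma finprod_homology_class:
  assumes Y: "subcomplex Y (cube n)" and "finite I" "x ` I \<subseteq> reduced_cycles Y p"
  shows "finprod (reduced_homology Y p) (\<lambda>i. homology_class Y p (x i) [^]\<^bsub>reduced_homology Y p\<^esub> (c i :: int)) I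
      = homology_class Y p (\<Sum>i\<in>I. frag_cmul (c i) (x i))
    \<and> (\<Sum>i\<in>I. frag_cmul (c i) (x i)) \<in> reduced_cycles Y p"
  using assms(2,3)
proof (induction I rule: finite_induct)
  case empty
  interpret H: comm_group "reduced_homology Y p" by (rule comm_group_reduced_homology[OF Y])
  show ?case
    by (simp add: one_reduced_homology reduced_cycles_def chain_group_def augmentation_def)
next
  case (insert j I)
  interpret H: comm_group "reduced_homology Y p" by (rule comm_group_reduced_homology[OF Y])
  have mem: "homology_class Y p (x i) [^]\<^bsub>reduced_homology Y p\<^esub> c i \<in> carrier (reduced_homology Y p)"
    if "i \<in> insert j I" for i
    using insert.prems that by (intro H.int_pow_closed) (auto simp: carrier_reduced_homology)
  have xj: "x j \<in> reduced_cycles Y p" using insert.prems by simp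
  have IH: "finprod (reduced_homology Y p) (\<lambda>i. homology_class Y p (x i) [^]\<^bsub>reduced_homology Y p\<^esub> c i) I
      = homology_class Y p (\<Sum>i\<in>I. frag_cmul (c i) (x i))"
    "(\<Sum>i\<in>I. frag_cmul (c i) (x i)) \<in> reduced_cycles Y p"
    using insert by auto
  have "(\<Sum>i\<in>insert j I. frag_cmul (c i) (x i)) \<in> reduced_cycles Y p"
  proof -
    have "frag_cmul (c j) (x j) - (0 - (\<Sum>i\<in>I. frag_cmul (c i) (x i))) \<in> reduced_cycles Y p"
      by (intro reduced_cycle_diff homology_class_int_pow(2)[OF Y] xj IH)
        (simp add: reduced_cycles_def chain_group_def augmentation_def)
    then show ?thesis using insert by simp
  qed
  moreover have "finprod (reduced_homology Y p)
      (\<lambda>i. homology_class Y p (x i) [^]\<^bsub>reduced_homology Y p\<^esub> c i) (insert j I)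
      = homology_class Y p (\<Sum>i\<in>insert j I. frag_cmul (c i) (x i))"
    using insert mem homology_class_int_pow[OF Y xj, of "c j"]
    by (subst H.finprod_insert)
      (auto simp: IH(1) carrier_reduced_homology homology_class_mult[OF Y _ IH(2)])
  ultimately show ?case by blast
qed

section \<open>Betti numbers of the skeletons\<close>

text \<open>
  Padded with zero rows, the coefficient matrix is square and singular.
\<close>

lemma int_dependency:
  fixes f :: "'e \<Rightarrow> 'a \<Rightarrow> int"
  assumes "finite S" "length es < card S"
  shows "\<exists>c. (\<exists>x\<in>S. c x \<noteq> 0) \<and> (\<forall>e\<in>set es. (\<Sum>x\<in>S. f e x * c x) = 0)"
proof -
  define xs where "xs = enum_set S"
  have xs: "distinct xs" "set xs = S" "length xs = card S"
    using enum_set[OF assms(1)] by (auto simp: xs_def)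
  define m where "m = card S"
  define A where "A = mat m m (\<lambda>(i, j). if i < length es then f (es ! i) (xs ! j) else 0)"
  have A: "A \<in> carrier_mat m m" by (simp add: A_def)
  have "transpose_mat A *\<^sub>v unit_vec m (m - 1) = 0\<^sub>v m"
  proof (rule eq_vecI)
    fix i assume "i < dim_vec (0\<^sub>v m :: int vec)"
    then have i: "i < m" by simp
    have last: "m - 1 < m" "\<not> m - 1 < length es" using assms(2) by (auto simp: m_def)
    have "(transpose_mat A *\<^sub>v unit_vec m (m - 1)) $ i = A $$ (m - 1, i)"
      using A i last by (simp add: scalar_prod_right_unit[of _ m])
    also have "\<dots> = 0" using i last by (simp add: A_def)
    finally show "(transpose_mat A *\<^sub>v unit_vec m (m - 1)) $ i = 0\<^sub>v m $ i" using i by simp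
  qed (use A in simp)
  moreover have "unit_vec m (m - 1) \<noteq> (0\<^sub>v m :: int vec)"
  proof
    assume "unit_vec m (m - 1) = (0\<^sub>v m :: int vec)"
    then have "unit_vec m (m - 1) $ (m - 1) = (0\<^sub>v m :: int vec) $ (m - 1)" by simp
    then show False using assms(2) by (simp add: m_def)
  qed
  ultimately have "\<exists>v. v \<in> carrier_vec m \<and> v \<noteq> 0\<^sub>v m \<and> transpose_mat A *\<^sub>v v = 0\<^sub>v m"
    using unit_vec_carrier by blast
  then have "det (transpose_mat A) = 0"
    using det_0_iff_vec_prod_zero[of "transpose_mat A" m] A by simp
  then have "det A = 0" using det_transpose[OF A] by simp
  then obtain v where v: "v \<in> carrier_vec m" "v \<noteq> 0\<^sub>v m" "A *\<^sub>v v = 0\<^sub>v m"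
    using det_0_iff_vec_prod_zero[OF A] by blast
  obtain c where c: "\<And>j. j < length xs \<Longrightarrow> c (xs ! j) = v $ j"
    using nth_extension[OF xs(1), of "\<lambda>j. v $ j"] by blast
  obtain j where "j < m" "v $ j \<noteq> 0" using v(1,2) by (metis carrier_vecD eq_vecI index_zero_vec)
  then have "\<exists>x\<in>S. c x \<noteq> 0"
    using c xs by (intro bexI[of _ "xs ! j"]) (auto simp: m_def)
  moreover have "(\<Sum>x\<in>S. f e x * c x) = 0" if e: "e \<in> set es" for e
  proof -
    obtain i where i: "i < length es" "es ! i = e" using e by (auto simp: in_set_conv_nth)
    have "(A *\<^sub>v v) $ i = 0" using v(3) i assms(2) by (simp add: m_def)
    then have "(\<Sum>j<m. f e (xs ! j) * v $ j) = 0"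
      using i assms(2) v(1) by (simp add: A_def scalar_prod_def m_def atLeast0LessThan)
    then have "(\<Sum>j<length xs. f e (xs ! j) * c (xs ! j)) = 0"
      using c by (simp add: m_def xs(3))
    then show ?thesis
      using sum_nth_distinct[OF xs(1), of "\<lambda>x. f e x * c x"] xs(2) by simp
  qed
  ultimately show ?thesis by blast
qed

lemma int_independentD:
  "int_independent G S \<Longrightarrow> finprod G (\<lambda>x. x [^]\<^bsub>G\<^esub> (c x :: int)) S = \<one>\<^bsub>G\<^esub> \<Longrightarrow> x \<in> S \<Longrightarrow> c x = 0"
  by (simp add: int_independent_def)

lemma lookup_frag_sum:
  "Poly_Mapping.lookup (\<Sum>i\<in>I. frag_cmul (c i) (x i)) e = (\<Sum>i\<in>I. c i * Poly_Mapping.lookup (x i) e)"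
  by (simp add: lookup_sum)

lemma cells_skeleton: "cells (skeleton Y q) p = (if p \<le> q then cells Y p else {})"
  by (auto simp: cells_def skeleton_def)

lemma face_dim_mono:
  assumes "length F = length G" "realization F \<subseteq> realization G"
  shows "face_dim F \<le> face_dim G" and "face_dim F = face_dim G \<Longrightarrow> F = G"
proof -
  have sub: "\<And>i. i < length G \<Longrightarrow> G ! i = Star \<or> F ! i = G ! i"
    using assms by (simp add: realization_subset)
  have stars: "{i. i < length F \<and> F ! i = Star} \<subseteq> {i. i < length G \<and> G ! i = Star}"
    using sub assms(1) by force
  then show "face_dim F \<le> face_dim G" unfolding face_dim_def by (intro card_mono) auto
  assume "face_dim F = face_dim G"
  then have "{i. i < length F \<and> F ! i = Star} = {i. i < length G \<and> G ! i = Star}"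
    using stars unfolding face_dim_def by (intro card_subset_eq) auto
  then have "i < length G \<Longrightarrow> F ! i = Star \<longleftrightarrow> G ! i = Star" for i
    using assms(1) by (auto simp: set_eq_iff)
  then show "F = G" using sub assms(1) by (intro nth_equalityI) (simp, metis)
qed

lemma subcomplex_skeleton_union:
  assumes S: "S \<subseteq> cells (cube n) (Suc p)"
  shows "subcomplex (skeleton (cube n) p \<union> S) (cube n)"
  unfolding subcomplex_def
proof (intro conjI ballI impI)
  show "skeleton (cube n) p \<union> S \<subseteq> cube n" using S by (auto simp: skeleton_def cells_def)
  fix G F assume G: "G \<in> skeleton (cube n) p \<union> S" and F: "F \<in> cube n"
    and sub: "realization F \<subseteq> realization G"
  have len: "length F = length G" using G F S by (auto simp: cube_def skeleton_def cells_def)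
  show "F \<in> skeleton (cube n) p \<union> S"
    using face_dim_mono[OF len sub] G F S
    by (cases "face_dim F = face_dim G") (auto simp: skeleton_def cells_def)
qed

lemma skeleton_Suc: "skeleton Y (Suc p) = skeleton Y p \<union> cells Y (Suc p)"
  by (auto simp: skeleton_def cells_def)

lemma subcomplex_skeleton: "subcomplex (skeleton (cube n) (Suc p)) (cube n)"
  unfolding skeleton_Suc by (rule subcomplex_skeleton_union) simp

lemma reduced_betti_skeleton_lower: "reduced_betti (skeleton (cube n) (Suc p)) p = 0"
proof -
  let ?Z = "skeleton (cube n) (Suc p)"
  let ?H = "reduced_homology ?Z p"
  interpret H: comm_group ?H by (rule comm_group_reduced_homology[OF subcomplex_skeleton])
  have triv: "x = \<one>\<^bsub>?H\<^esub>" if x: "x \<in> carrier ?H" for x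
  proof -
    obtain z where z: "z \<in> reduced_cycles ?Z p" "x = homology_class ?Z p z"
      using x by (auto simp: carrier_reduced_homology)
    then have "z \<in> reduced_cycles (cube n) p"
      by (simp add: reduced_cycles_def chain_group_def cells_skeleton)
    then obtain c where "Poly_Mapping.keys c \<subseteq> set (star_list n p)" "z = bd c"
      by (rule cube_cycle_is_star_boundary)
    then have "z \<in> boundaries ?Z p"
      using set_star_list_subset[of n p]
      by (auto simp: boundaries_def chain_group_def cells_skeleton)
    then show ?thesis
      using z(2) by (simp add: one_reduced_homology homology_class_eq_iff)
  qed
  have "S = {}" if S: "int_independent ?H S" for S
  proof (rule ccontr)
    assume "S \<noteq> {}"
    then obtain x where x: "x \<in> S" by blast
    \<comment> \<open>in a trivial group the exponents \<open>1\<close> give a relation\<close>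
    have "finprod ?H (\<lambda>x. x [^]\<^bsub>?H\<^esub> (1 :: int)) S = \<one>\<^bsub>?H\<^esub>"
      using S triv by (intro H.finprod_one_eqI) (auto simp: int_independent_def)
    from int_independentD[of ?H S "\<lambda>_. 1", OF S this x] show False by simp
  qed
  moreover have "int_independent ?H {}" by (simp add: int_independent_def)
  ultimately have "{card S |S. int_independent ?H S} = {0}" by force
  then show ?thesis by (simp add: reduced_betti_def abelian_rank_def)
qed

text \<open>
  Nothing bounds in the top dimension, so the homology group is the group of cycles. Coordinates in
  \<open>one_list\<close> bound its rank from above, and the boundaries of the cells in \<open>star_list\<close> attain the bound.
\<close>

lemma reduced_betti_skeleton_top:
  "reduced_betti (skeleton (cube n) p) p = length (one_list n p)" if pos: "0 < p"
proof -
  obtain q where p: "p = Suc q" using pos by (cases p) auto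
  let ?Z = "skeleton (cube n) p"
  let ?H = "reduced_homology ?Z p"
  let ?cl = "homology_class ?Z p"
  have sub: "subcomplex ?Z (cube n)" unfolding p by (rule subcomplex_skeleton)
  interpret H: comm_group ?H by (rule comm_group_reduced_homology[OF sub])
  have "boundaries ?Z p = {0}"
    by (auto simp: boundaries_def chain_group_def cells_skeleton image_iff)
  then have cl: "?cl z = {z}" for z by (simp add: homology_class_def)
  have cyc: "reduced_cycles ?Z p = reduced_cycles (cube n) p"
    by (simp add: reduced_cycles_def chain_group_def cells_skeleton)
  have upper: "card S \<le> length (one_list n p)" if S: "int_independent ?H S" for S
  proof (rule ccontr)
    assume "\<not> card S \<le> length (one_list n p)"
    moreover have fin: "finite S" using S by (simp add: int_independent_def)
    ultimately obtain c where c: "\<exists>x\<in>S. c x \<noteq> 0"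
      "\<And>e. e \<in> set (one_list n p) \<Longrightarrow> (\<Sum>x\<in>S. Poly_Mapping.lookup (the_elem x) e * c x) = 0"
      using int_dependency[of S "one_list n p" "\<lambda>e x. Poly_Mapping.lookup (the_elem x) e"] by auto
    have mem: "the_elem x \<in> reduced_cycles ?Z p" "?cl (the_elem x) = x" if "x \<in> S" for x
      using S that by (auto simp: int_independent_def carrier_reduced_homology cl)
    have "finprod ?H (\<lambda>x. x [^]\<^bsub>?H\<^esub> c x) S = finprod ?H (\<lambda>x. ?cl (the_elem x) [^]\<^bsub>?H\<^esub> c x) S"
      using S mem by (intro H.finprod_cong') (auto simp: int_independent_def intro!: H.int_pow_closed)
    also have "\<dots> = ?cl (\<Sum>x\<in>S. frag_cmul (c x) (the_elem x))"
      using finprod_homology_class[OF sub fin, of the_elem p c] mem by auto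
    also have "(\<Sum>x\<in>S. frag_cmul (c x) (the_elem x)) = 0"
    proof (rule reduced_cycle_eq_0)
      show "(\<Sum>x\<in>S. frag_cmul (c x) (the_elem x)) \<in> reduced_cycles (cube n) p"
        using finprod_homology_class[OF sub fin, of the_elem p c] mem cyc by auto
      show "Poly_Mapping.lookup (\<Sum>x\<in>S. frag_cmul (c x) (the_elem x)) e = 0"
        if "e \<in> set (one_list n p)" for e
        using c(2)[OF that] by (simp only: lookup_frag_sum mult.commute)
    qed
    finally have "finprod ?H (\<lambda>x. x [^]\<^bsub>?H\<^esub> c x) S = \<one>\<^bsub>?H\<^esub>"
      by (simp only: one_reduced_homology)
    from int_independentD[of ?H S c, OF S this] show False using c(1) by blast
  qed
  let ?b = "\<lambda>a. ?cl (cell_boundary a)"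
  have indep: "c a = 0"
    if zero: "(\<Sum>a\<in>set (star_list n p). frag_cmul (c a) (cell_boundary a)) = 0"
      and a: "a \<in> set (star_list n p)" for a c
  proof -
    obtain v where v: "\<And>a a'. a \<in> set (star_list n p) \<Longrightarrow> a' \<in> set (star_list n p) \<Longrightarrow>
      (\<Sum>e\<in>set (one_list n p). v e a * incidence a' e) = (if a = a' then 1 else 0)"
      using one_star_inverse[of n p] by metis
    have zero': "(\<Sum>a'\<in>set (star_list n p). c a' * incidence a' e) = 0" for e
      using arg_cong[OF zero, of "\<lambda>z. Poly_Mapping.lookup z e"]
      by (simp add: lookup_sum incidence_def)
    have "c a = (\<Sum>a'\<in>set (star_list n p). if a = a' then c a' else 0)" using a by simp
    also have "\<dots> = (\<Sum>a'\<in>set (star_list n p). (\<Sum>e\<in>set (one_list n p). v e a * incidence a' e) * c a')"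
      by (rule sum.cong) (auto simp: v[OF a])
    also have "\<dots> = (\<Sum>e\<in>set (one_list n p). v e a * (\<Sum>a'\<in>set (star_list n p). c a' * incidence a' e))"
      by (rule sum_mult_swap)
    finally show ?thesis by (simp add: zero')
  qed
  have inj: "inj_on ?b (set (star_list n p))"
  proof (rule inj_onI)
    fix a a' assume a: "a \<in> set (star_list n p)" "a' \<in> set (star_list n p)" and "?b a = ?b a'"
    then have eq: "cell_boundary a = cell_boundary a'" by (simp add: cl)
    show "a = a'"
    proof (rule ccontr)
      assume ne: "a \<noteq> a'"
      let ?c = "\<lambda>x. (if x = a then 1 else 0) - (if x = a' then 1 else 0) :: int"
      have "(\<Sum>x\<in>set (star_list n p). frag_cmul (?c x) (cell_boundary x)) = 0"
      proof (rule poly_mapping_eqI)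
        fix e
        show "Poly_Mapping.lookup (\<Sum>x\<in>set (star_list n p). frag_cmul (?c x) (cell_boundary x)) e
            = Poly_Mapping.lookup 0 e"
          unfolding lookup_frag_sum left_diff_distrib sum_subtractf
          using a eq by (simp add: if_distrib[of "\<lambda>c. c * _"] cong: if_cong)
      qed
      from indep[of ?c, OF this a(1)] show False using ne by simp
    qed
  qed
  have bc: "cell_boundary a \<in> reduced_cycles ?Z p" if "a \<in> set (star_list n p)" for a
    using bd_star_in_cycles[of "frag_of a" n p] that by (simp add: cyc)
  then have bcarr: "?b a \<in> carrier ?H" if "a \<in> set (star_list n p)" for a
    using that by (simp add: carrier_reduced_homology)
  have "int_independent ?H (?b ` set (star_list n p))"
    unfolding int_independent_def
  proof (intro conjI allI impI)
    show "finite (?b ` set (star_list n p))" by simp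
    show "?b ` set (star_list n p) \<subseteq> carrier ?H" using bc by (auto simp: carrier_reduced_homology)
    fix c :: "(face \<Rightarrow>\<^sub>0 int) set \<Rightarrow> int"
    assume one: "finprod ?H (\<lambda>x. x [^]\<^bsub>?H\<^esub> c x) (?b ` set (star_list n p)) = \<one>\<^bsub>?H\<^esub>"
    have "finprod ?H (\<lambda>x. x [^]\<^bsub>?H\<^esub> c x) (?b ` set (star_list n p))
        = finprod ?H (\<lambda>a. ?b a [^]\<^bsub>?H\<^esub> c (?b a)) (set (star_list n p))"
      using inj bcarr by (intro H.finprod_reindex) (auto intro!: H.int_pow_closed)
    also have "\<dots> = ?cl (\<Sum>a\<in>set (star_list n p). frag_cmul (c (?b a)) (cell_boundary a))"
      using finprod_homology_class[OF sub, of "set (star_list n p)" cell_boundary p "\<lambda>a. c (?b a)"] bc by auto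
    finally have "(\<Sum>a\<in>set (star_list n p). frag_cmul (c (?b a)) (cell_boundary a)) = 0"
      using one by (simp add: one_reduced_homology cl)
    then show "\<forall>x\<in>?b ` set (star_list n p). c x = 0"
      using indep[of "\<lambda>a. c (?b a)"] by blast
  qed
  moreover have "card (?b ` set (star_list n p)) = length (one_list n p)"
    by (simp add: card_image[OF inj] distinct_card[OF distinct_star_list])
  ultimately have "Sup {card S |S. int_independent ?H S} = length (one_list n p)"
    using upper by (intro cSup_eq_maximum) (auto intro: exI[of _ "?b ` set (star_list n p)"])
  then show ?thesis by (simp add: reduced_betti_def abelian_rank_def)
qed

section \<open>Counting spanning trees\<close>

definition tree_mat :: "nat \<Rightarrow> nat \<Rightarrow> face set \<Rightarrow> int mat" where
  "tree_mat n p S = list_mat (one_list n p) (enum_set S) (\<lambda>e c. incidence c e)"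

abbreviation one_coords :: "nat \<Rightarrow> nat \<Rightarrow> (face \<Rightarrow>\<^sub>0 int) \<Rightarrow> nat \<Rightarrow> int" where
  "one_coords n p z \<equiv> \<lambda>i. Poly_Mapping.lookup z (one_list n p ! i)"

lemma in_col_lattice_cong:
  assumes "\<And>i. i < dim_row A \<Longrightarrow> v i = v' i"
  shows "in_col_lattice A v \<longleftrightarrow> in_col_lattice A v'"
  using assms by (simp add: in_col_lattice_def)

text \<open>
  In \<open>one_list\<close> coordinates, the boundaries of a subcomplex form the lattice spanned by the columns of its
  \<open>(p + 1)\<close>-cells.
\<close>

lemma boundary_iff_in_lattice:
  assumes Y: "subcomplex Y (cube n)" and z: "z \<in> reduced_cycles (cube n) p"
  shows "z \<in> boundaries Y p \<longleftrightarrow> in_col_lattice (tree_mat n p (cells Y (Suc p))) (one_coords n p z)"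
proof -
  let ?S = "cells Y (Suc p)"
  let ?es = "one_list n p" and ?ss = "enum_set ?S"
  have sub: "?S \<subseteq> cells (cube n) (Suc p)" using Y by (auto simp: subcomplex_def cells_def)
  then have fin: "finite ?S" using finite_subset finite_cells_cube by blast
  note ss = enum_set[OF fin]
  have coords: "Poly_Mapping.lookup (bd c) e = (\<Sum>j<length ?ss. incidence (?ss ! j) e * Poly_Mapping.lookup c (?ss ! j))"
    if "Poly_Mapping.keys c \<subseteq> ?S" for c e
    using lookup_bd[OF fin that, of e] sum_nth_distinct[OF ss(1), of "\<lambda>G. incidence G e * Poly_Mapping.lookup c G"]
    by (simp add: ss(2) mult.commute)
  show ?thesis
  proof
    assume "z \<in> boundaries Y p"
    then obtain c where c: "Poly_Mapping.keys c \<subseteq> ?S" "z = bd c"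
      by (auto simp: boundaries_def chain_group_def)
    then show "in_col_lattice (tree_mat n p ?S) (one_coords n p z)"
      unfolding in_col_lattice_def
      by (intro exI[of _ "\<lambda>j. Poly_Mapping.lookup c (?ss ! j)"]) (simp add: tree_mat_def coords)
  next
    assume "in_col_lattice (tree_mat n p ?S) (one_coords n p z)"
    then obtain w where w: "\<And>i. i < length ?es \<Longrightarrow>
        Poly_Mapping.lookup z (?es ! i) = (\<Sum>j<length ?ss. incidence (?ss ! j) (?es ! i) * w j)"
      by (auto simp: in_col_lattice_def tree_mat_def)
    obtain g where g: "\<And>j. j < length ?ss \<Longrightarrow> g (?ss ! j) = w j"
      using nth_extension[OF ss(1), of w] by blast
    obtain c where c: "Poly_Mapping.keys c \<subseteq> ?S" "\<And>G. G \<in> ?S \<Longrightarrow> Poly_Mapping.lookup c G = g G"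
      using chain_ex[OF fin, of g] by blast
    have cw: "Poly_Mapping.lookup c (?ss ! j) = w j" if "j < length ?ss" for j
      using c(2) g that ss(2) nth_mem by metis
    have b: "bd c \<in> boundaries Y p" using c(1) by (auto simp: boundaries_def chain_group_def)
    have "bd c \<in> boundaries (cube n) p"
      using c(1) sub by (auto simp: boundaries_def chain_group_def)
    then have "bd c \<in> reduced_cycles (cube n) p"
      using boundaries_subset_reduced_cycles[OF subcomplex_cube] by blast
    then have "z - bd c \<in> reduced_cycles (cube n) p" by (rule reduced_cycle_diff[OF z])
    moreover have "Poly_Mapping.lookup (z - bd c) e = 0" if e: "e \<in> set ?es" for e
    proof -
      obtain i where i: "i < length ?es" "e = ?es ! i" using e by (auto simp: in_set_conv_nth)
      show ?thesis
        unfolding i(2) lookup_minus w[OF i(1)] coords[OF c(1)] by (simp add: cw)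
    qed
    ultimately have "z - bd c = 0" by (rule reduced_cycle_eq_0)
    then show "z \<in> boundaries Y p" using b by simp
  qed
qed

lemma cube_cycle_ex:
  obtains z where "z \<in> reduced_cycles (cube n) p" "\<And>i. i < length (one_list n p) \<Longrightarrow> one_coords n p z i = f i"
  using reduced_cycle_lift[of n p f] bd_star_in_cycles[of _ n p] by blast

text \<open>
  The homology group is the quotient of all coordinate vectors by the column lattice of \<open>A\<close>, so its
  order is the index of this lattice.
\<close>

lemma order_reduced_homology:
  assumes Y: "subcomplex Y (cube n)" and skel: "skeleton (cube n) p \<subseteq> Y"
    and card: "card (cells Y (Suc p)) = length (one_list n p)"
  defines "A \<equiv> tree_mat n p (cells Y (Suc p))"
  shows "finite (carrier (reduced_homology Y p)) \<longleftrightarrow> det A \<noteq> 0"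
    and "det A \<noteq> 0 \<Longrightarrow> int (Coset.order (reduced_homology Y p)) = \<bar>det A\<bar>"
proof -
  let ?r = "length (one_list n p)"
  have "cells Y (Suc p) \<subseteq> cells (cube n) (Suc p)" using Y by (auto simp: subcomplex_def cells_def)
  then have fin: "finite (cells Y (Suc p))" using finite_subset finite_cells_cube by blast
  have A: "A \<in> carrier_mat ?r ?r"
    using enum_set(3)[OF fin] card by (simp add: A_def tree_mat_def carrier_matI)
  have "cells Y p = cells (cube n) p"
    using Y skel by (auto simp: subcomplex_def cells_def skeleton_def)
  then have cyc: "reduced_cycles Y p = reduced_cycles (cube n) p"
    by (simp add: reduced_cycles_def chain_group_def)
  let ?co = "one_coords n p" and ?cl = "homology_class Y p"
  have cl_eq: "?cl z = ?cl z' \<longleftrightarrow> in_col_lattice A (\<lambda>i. ?co z i - ?co z' i)"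
    if "z \<in> reduced_cycles Y p" "z' \<in> reduced_cycles Y p" for z z'
    using boundary_iff_in_lattice[OF Y, of "z - z'" p] reduced_cycle_diff[OF that]
    by (simp add: homology_class_eq_iff cyc A_def lookup_minus)
  have "\<exists>z. z \<in> reduced_cycles Y p \<and> (\<forall>i<?r. ?co z i = f i)" for f
    unfolding cyc by (rule cube_cycle_ex[of n p f]) blast
  then obtain lift where lift: "lift f \<in> reduced_cycles Y p" "\<And>i. i < ?r \<Longrightarrow> ?co (lift f) i = f i" for f
    by metis
  have index: "finite (carrier (reduced_homology Y p)) \<and>
      int (Coset.order (reduced_homology Y p)) = \<bar>det A\<bar>" if nz: "det A \<noteq> 0"
  proof -
    obtain T where T: "finite T" "int (card T) = \<bar>det A\<bar>" "transversal A T"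
      using transversal_det[OF A nz] by blast
    have "bij_betw (\<lambda>t. ?cl (lift t)) T (carrier (reduced_homology Y p))"
      unfolding bij_betw_def
    proof (intro conjI inj_onI equalityI subsetI)
      fix t t' assume t: "t \<in> T" "t' \<in> T" and "?cl (lift t) = ?cl (lift t')"
      then have "in_col_lattice A (\<lambda>i. ?co (lift t) i - ?co (lift t') i)"
        by (simp add: cl_eq lift)
      then have "in_col_lattice A (\<lambda>i. t i - t' i)"
        using A by (subst in_col_lattice_cong[of A _ "\<lambda>i. ?co (lift t) i - ?co (lift t') i"]) (auto simp: lift)
      then show "t = t'" using T(3) t by (auto simp: transversal_def)
    next
      fix X assume "X \<in> (\<lambda>t. ?cl (lift t)) ` T"
      then show "X \<in> carrier (reduced_homology Y p)" using lift by (auto simp: carrier_reduced_homology)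
    next
      fix X assume "X \<in> carrier (reduced_homology Y p)"
      then obtain z where z: "z \<in> reduced_cycles Y p" "X = ?cl z" by (auto simp: carrier_reduced_homology)
      obtain t where t: "t \<in> T" "in_col_lattice A (\<lambda>i. ?co z i - t i)"
        using T(3)[unfolded transversal_def, THEN conjunct1, THEN spec[of _ "?co z"]] by (elim bexE)
      have "in_col_lattice A (\<lambda>i. ?co z i - ?co (lift t) i)"
        using A t(2) by (subst in_col_lattice_cong[of A _ "\<lambda>i. ?co z i - t i"]) (auto simp: lift)
      then have "X = ?cl (lift t)" using z lift by (simp add: cl_eq)
      then show "X \<in> (\<lambda>t. ?cl (lift t)) ` T" using t(1) by blast
    qed
    then show ?thesis
      using T(1,2) bij_betw_finite bij_betw_same_card by (fastforce simp: Coset.order_def)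
  qed
  then show "det A \<noteq> 0 \<Longrightarrow> int (Coset.order (reduced_homology Y p)) = \<bar>det A\<bar>" by blast
  show "finite (carrier (reduced_homology Y p)) \<longleftrightarrow> det A \<noteq> 0"
  proof
    assume finH: "finite (carrier (reduced_homology Y p))"
    have "\<exists>z. z \<in> reduced_cycles Y p \<and> ?cl z = X" if "X \<in> carrier (reduced_homology Y p)" for X
      using that by (auto simp: carrier_reduced_homology)
    then obtain rep where rep: "\<And>X. X \<in> carrier (reduced_homology Y p) \<Longrightarrow> rep X \<in> reduced_cycles Y p"
      "\<And>X. X \<in> carrier (reduced_homology Y p) \<Longrightarrow> ?cl (rep X) = X"
      by metis
    show "det A \<noteq> 0"
    proof (rule finite_cover_imp_det_nonzero[OF A])
      show "finite ((\<lambda>X. ?co (rep X)) ` carrier (reduced_homology Y p))" using finH by simp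
      fix v
      let ?X = "?cl (lift v)"
      have X: "?X \<in> carrier (reduced_homology Y p)" using lift by (auto simp: carrier_reduced_homology)
      then have "in_col_lattice A (\<lambda>i. ?co (lift v) i - ?co (rep ?X) i)"
        using cl_eq[of "lift v" "rep ?X"] rep lift by simp
      then have "in_col_lattice A (\<lambda>i. v i - ?co (rep ?X) i)"
        using A by (subst in_col_lattice_cong[of A _ "\<lambda>i. ?co (lift v) i - ?co (rep ?X) i"]) (auto simp: lift)
      then show "\<exists>t\<in>(\<lambda>X. ?co (rep X)) ` carrier (reduced_homology Y p). in_col_lattice A (\<lambda>i. v i - t i)"
        using imageI[OF X, of "\<lambda>X. ?co (rep X)"] by (rule bexI)
    qed
  qed (use index in blast)
qed

lemma trivial_top_homology:
  assumes Y: "subcomplex Y (cube n)" and dim: "cells Y (Suc (Suc p)) = {}"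
    and card: "card (cells Y (Suc p)) = length (one_list n p)"
    and det: "det (tree_mat n p (cells Y (Suc p))) \<noteq> 0"
  shows "trivial_group (reduced_homology Y (Suc p))"
proof -
  let ?S = "cells Y (Suc p)" and ?r = "length (one_list n p)"
  let ?ss = "enum_set ?S" and ?A = "tree_mat n p (cells Y (Suc p))"
  have "?S \<subseteq> cells (cube n) (Suc p)" using Y by (auto simp: subcomplex_def cells_def)
  then have fin: "finite ?S" using finite_subset finite_cells_cube by blast
  note ss = enum_set[OF fin]
  have A: "?A \<in> carrier_mat ?r ?r"
    using ss(3) card by (simp add: tree_mat_def carrier_matI)
  have "z = 0" if z: "z \<in> reduced_cycles Y (Suc p)" for z
  proof -
    have keys: "Poly_Mapping.keys z \<subseteq> ?S" and bd: "bd z = 0"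
      using z by (simp_all add: reduced_cycles_def chain_group_def)
    let ?v = "vec ?r (\<lambda>j. Poly_Mapping.lookup z (?ss ! j))"
    have "?A *\<^sub>v ?v = 0\<^sub>v ?r"
    proof (rule eq_vecI)
      fix i assume "i < dim_vec (0\<^sub>v ?r :: int vec)"
      then have i: "i < ?r" by simp
      have "(?A *\<^sub>v ?v) $ i
          = (\<Sum>j<length ?ss. incidence (?ss ! j) (one_list n p ! i) * Poly_Mapping.lookup z (?ss ! j))"
        using i ss(3) card by (simp add: tree_mat_def scalar_prod_def atLeast0LessThan)
      also have "\<dots> = Poly_Mapping.lookup (bd z) (one_list n p ! i)"
        using lookup_bd[OF fin keys, of "one_list n p ! i"]
          sum_nth_distinct[OF ss(1), of "\<lambda>G. incidence G (one_list n p ! i) * Poly_Mapping.lookup z G"]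
        by (simp add: ss(2) mult.commute)
      finally show "(?A *\<^sub>v ?v) $ i = 0\<^sub>v ?r $ i" using i bd by simp
    qed (use A in simp)
    then have "?v = 0\<^sub>v ?r"
      using det det_0_iff_vec_prod_zero[OF A] by (metis vec_carrier)
    then have "Poly_Mapping.lookup z (?ss ! j) = 0" if "j < ?r" for j
      using that by (metis index_vec index_zero_vec(1))
    then have "Poly_Mapping.lookup z G = 0" if "G \<in> ?S" for G
      using that ss(2,3) card by (metis in_set_conv_nth)
    then show "z = 0" using keys by (auto intro!: poly_mapping_eqI simp: in_keys_iff)
  qed
  moreover have "0 \<in> reduced_cycles Y (Suc p)"
    by (simp add: reduced_cycles_def chain_group_def)
  ultimately have "reduced_cycles Y (Suc p) = {0}" by auto
  then have "carrier (reduced_homology Y (Suc p)) = {\<one>\<^bsub>reduced_homology Y (Suc p)\<^esub>}"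
    by (simp add: carrier_reduced_homology one_reduced_homology)
  moreover have "group (reduced_homology Y (Suc p))"
    using comm_group_reduced_homology[OF Y] by (simp add: comm_group_def)
  ultimately show ?thesis by (simp add: trivial_group_def)
qed

text \<open>
  The Betti numbers turn the condition on the number of cells into squareness of \<open>tree_mat\<close>. Then
  finiteness of the lower homology group says that its determinant is nonzero, which in turn makes the
  top homology group trivial.
\<close>

lemma spanning_trees_iff:
  assumes "p < n"
  shows "Y \<in> spanning_trees n (Suc p) \<longleftrightarrow>
    (\<exists>S. Y = skeleton (cube n) p \<union> S \<and> S \<subseteq> cells (cube n) (Suc p) \<and>
       card S = length (one_list n p) \<and> det (tree_mat n p S) \<noteq> 0)"
proof -
  let ?Z = "skeleton (cube n) (Suc p)"
  have count: "(let Z = ?Z in int (card (cells Y (Suc p))) =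
         int (card (cells Z (Suc p))) - int (reduced_betti Z (Suc p)) + int (reduced_betti Z (Suc p - 1)))
    \<longleftrightarrow> card (cells Y (Suc p)) = length (one_list n p)" for Y
    by (simp add: Let_def cells_skeleton card_cells_cube reduced_betti_skeleton_lower
        reduced_betti_skeleton_top)
  show ?thesis
  proof
    assume Y: "Y \<in> spanning_trees n (Suc p)"
    then have sub: "subcomplex Y (cube n)" and dim: "has_dim Y (Suc p)"
      and skel: "skeleton (cube n) p \<subseteq> Y" and fin: "finite (carrier (reduced_homology Y p))"
      and card: "card (cells Y (Suc p)) = length (one_list n p)"
      unfolding spanning_trees_def mem_Collect_eq count by simp_all
    have "Y = skeleton (cube n) p \<union> cells Y (Suc p)"
      using sub dim skel by (auto simp: subcomplex_def has_dim_def cells_def skeleton_def le_Suc_eq)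
    moreover have "cells Y (Suc p) \<subseteq> cells (cube n) (Suc p)"
      using sub by (auto simp: subcomplex_def cells_def)
    ultimately show "\<exists>S. Y = skeleton (cube n) p \<union> S \<and> S \<subseteq> cells (cube n) (Suc p) \<and>
       card S = length (one_list n p) \<and> det (tree_mat n p S) \<noteq> 0"
      using order_reduced_homology(1)[OF sub skel card] fin card by blast
  next
    assume "\<exists>S. Y = skeleton (cube n) p \<union> S \<and> S \<subseteq> cells (cube n) (Suc p) \<and>
       card S = length (one_list n p) \<and> det (tree_mat n p S) \<noteq> 0"
    then obtain S where Y: "Y = skeleton (cube n) p \<union> S" and S: "S \<subseteq> cells (cube n) (Suc p)"
      and card: "card S = length (one_list n p)" and det: "det (tree_mat n p S) \<noteq> 0" by blast
    have cells: "cells Y (Suc p) = S" "cells Y (Suc (Suc p)) = {}"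
      using S by (auto simp: Y cells_def skeleton_def)
    have sub: "subcomplex Y (cube n)" unfolding Y by (rule subcomplex_skeleton_union[OF S])
    have skel: "skeleton (cube n) p \<subseteq> Y" by (simp add: Y)
    have "S \<noteq> {}" using card one_list_nonempty[OF assms] by auto
    then have "has_dim Y (Suc p)"
      using S by (force simp: Y has_dim_def cells_def skeleton_def)
    moreover have "trivial_group (reduced_homology Y (Suc p))"
      using trivial_top_homology[OF sub cells(2)] card det by (simp add: cells)
    moreover have "finite (carrier (reduced_homology Y p))"
      using order_reduced_homology(1)[OF sub skel] card det by (simp add: cells)
    ultimately show "Y \<in> spanning_trees n (Suc p)"
      using sub skel card unfolding spanning_trees_def mem_Collect_eq count by (simp add: cells)
  qed
qed

text \<open>
  Sets of cells with vanishing determinant are no trees and contribute nothing to the Cauchy--Binet sum.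
\<close>

theorem tree_number_eq_tree_det:
  assumes "p < n"
  shows "int (tree_number n (Suc p)) = tree_det n p"
proof -
  let ?C = "cells (cube n) (Suc p)" and ?r = "length (one_list n p)"
  let ?B = "{S. S \<subseteq> ?C \<and> card S = ?r \<and> det (tree_mat n p S) \<noteq> 0}"
  let ?Y = "\<lambda>S. skeleton (cube n) p \<union> S"
  have cells: "cells (?Y S) (Suc p) = S" if "S \<subseteq> ?C" for S
    using that by (auto simp: cells_def skeleton_def)
  have image: "spanning_trees n (Suc p) = ?Y ` ?B"
    by (rule Set.set_eqI) (simp only: spanning_trees_iff[OF assms] image_iff bex_simps mem_Collect_eq, blast)
  have inj: "inj_on ?Y ?B" by (rule inj_onI) (metis (no_types, lifting) cells mem_Collect_eq)
  have "int (tree_number n (Suc p)) = (\<Sum>S\<in>?B. (int (Coset.order (reduced_homology (?Y S) p)))\<^sup>2)"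
    unfolding tree_number_def image by (simp add: sum.reindex[OF inj])
  also have "\<dots> = (\<Sum>S\<in>?B. (det (tree_mat n p S))\<^sup>2)"
  proof (rule sum.cong[OF refl])
    fix S assume S: "S \<in> ?B"
    then have "int (Coset.order (reduced_homology (?Y S) p)) = \<bar>det (tree_mat n p S)\<bar>"
      using order_reduced_homology(2)[OF subcomplex_skeleton_union, of S n p] by (simp add: cells)
    then show "(int (Coset.order (reduced_homology (?Y S) p)))\<^sup>2 = (det (tree_mat n p S))\<^sup>2" by simp
  qed
  also have "\<dots> = (\<Sum>S | S \<subseteq> ?C \<and> card S = ?r. (det (tree_mat n p S))\<^sup>2)"
    by (rule sum.mono_neutral_left) auto
  also have "\<dots> = tree_det n p" by (simp add: tree_det_cauchy_binet tree_mat_def)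
  finally show ?thesis .
qed

theorem corollary3p5:
  fixes n k :: nat
  assumes "n \<ge> 1" and "1 \<le> k" and "k \<le> n"
  shows "tree_number n k =
    (\<Prod>j = k + 1..n. (2 * j) ^ ((n choose j) * ((j - 2) choose (k - 1))))"
proof -
  obtain p where p: "k = Suc p" "p < n" using assms by (cases k) auto
  have "int (tree_number n k) = (\<Prod>j = p + 2..n. (2 * int j) ^ ((n choose j) * ((j - 2) choose p)))"
    using tree_number_eq_tree_det[OF p(2)] tree_det_formula[of n p] p(1) by simp
  also have "\<dots> = int (\<Prod>j = k + 1..n. (2 * j) ^ ((n choose j) * ((j - 2) choose (k - 1))))"
    by (simp add: p(1))
  finally show ?thesis by (simp only: of_nat_eq_iff)
qed

end
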